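(* Let $G$ be a semisimple Lie group with Lie algebra $\mathfrak{g}$, Killing form $\kappa(\cdot,\cdot)$, and a left-invariant Riemannian metric $\langle u,v\rangle=\kappa(u,\Lambda v)$ generated by an invertible symmetric inertia operator $\Lambda\colon\mathfrak{g}\to\mathfrak{g}$. Suppose $u_0\in\mathfrak{g}$ is a semisimple regular element and that $\Lambda$ maps the centralizer $C(u_0):=\ker(\mathrm{ad}_{u_0})$ to itself. Then $u_0$ is a steady solution of the Euler-Arnold equation, i.e. $[u_0,\Lambda u_0]=0$. If $\Lambda u_0$ is also a semisimple regular element, let $\Omega:=C(u_0)^\perp$, $A:=\mathrm{ad}_{u_0}$ and $F:=\Lambda^{-1}(\mathrm{ad}_{\Lambda u_0}-\mathrm{ad}_{u_0}\Lambda)$. Then $A$ and $F$ map $\Omega$ to itself, the operator $\mathrm{ad}_{\Lambda u_0}$ is invertible on $\Omega$, and $$S=(\mathrm{ad}_{\Lambda u_0})^{-1}\Lambda$$ maps $\Omega$ to itself and solves $SF+AS=I$ on $\Omega$. Hence there is a conjugate point along the geodesic $\exp(tu_0)$ if for some $\tau>0$ we have $$\det\left(e^{\tau\Lambda F\Lambda^{-1}}-e^{-\tau A}\right)=0,$$ the determinant being that of the operator on $\Omega$.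
   Context: An element is regular if its centralizer has minimal dimension; an element $u$ is semisimple if $\mathrm{ad}_u$ is diagonalizable over $\mathbb{C}$. The complement $C(u_0)^\perp$ is the same whether computed in $\kappa$ or in $\langle\cdot,\cdot\rangle$, since the symmetric operator $\Lambda$ preserves $C(u_0)$. The curve $t\mapsto\exp(tu_0)$ is a geodesic when $[u_0,\Lambda u_0]=0$. There is a conjugate point along a geodesic if some nontrivial Jacobi field along it vanishes at $t=0$ and at some $t>0$. *)

theory Defs
  imports
    "HOL-Analysis.Analysis"
    "HOL-Algebra.Group"
    "Jordan_Normal_Form.Determinant"
begin

section \<open>Smoothness and smooth atlases\<close>

text \<open>C^k on an open set, via iterated directional derivatives.  On a finite-dimensional domain
  this is the usual notion: f is C^(k+1) iff it is differentiable and every x \<mapsto> Df(x)v is C^k.\<close>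

primrec Ck_on ::
    "nat \<Rightarrow> 'x::real_normed_vector set \<Rightarrow> ('x \<Rightarrow> 'y::real_normed_vector) \<Rightarrow> bool" where
  "Ck_on 0 S f \<longleftrightarrow> continuous_on S f"
| "Ck_on (Suc k) S f \<longleftrightarrow>
     (\<forall>x\<in>S. f differentiable at x) \<and> (\<forall>v. Ck_on k S (\<lambda>x. frechet_derivative f (at x) v))"

definition smooth_on :: "'x::real_normed_vector set \<Rightarrow> ('x \<Rightarrow> 'y::real_normed_vector) \<Rightarrow> bool" where
  "smooth_on S f \<longleftrightarrow> (\<forall>k. Ck_on k S f)"

text \<open>A chart is a pair of its domain and the coordinate map, which is only meaningful on the
  domain.\<close>

type_synonym ('g, 'a) chart = "'g set \<times> ('g \<Rightarrow> 'a)"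

definition atlas_space :: "('g, 'a) chart set \<Rightarrow> 'g set" where
  "atlas_space \<A> = (\<Union>(U, \<phi>)\<in>\<A>. U)"

definition smooth_manifold :: "'g topology \<Rightarrow> ('g, 'a::euclidean_space) chart set \<Rightarrow> bool" where
  "smooth_manifold T \<A> \<longleftrightarrow>
     Hausdorff_space T \<and> second_countable T \<and> atlas_space \<A> = topspace T \<and>
     (\<forall>(U, \<phi>)\<in>\<A>. openin T U \<and> open (\<phi> ` U) \<and>
        homeomorphic_map (subtopology T U) (top_of_set (\<phi> ` U)) \<phi>) \<and>
     (\<forall>(U, \<phi>)\<in>\<A>. \<forall>(V, \<psi>)\<in>\<A>. smooth_on (\<phi> ` (U \<inter> V)) (\<lambda>x. \<psi> (inv_into U \<phi> x)))"

definition smooth_fun ::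
    "('g, 'a::euclidean_space) chart set \<Rightarrow> ('g \<Rightarrow> 'b::real_normed_vector) \<Rightarrow> bool" where
  "smooth_fun \<A> f \<longleftrightarrow> (\<forall>(U, \<phi>)\<in>\<A>. smooth_on (\<phi> ` U) (\<lambda>x. f (inv_into U \<phi> x)))"

definition smooth_curve ::
    "'g topology \<Rightarrow> ('g, 'a::euclidean_space) chart set \<Rightarrow> (real \<Rightarrow> 'g) \<Rightarrow> bool" where
  "smooth_curve T \<A> \<gamma> \<longleftrightarrow> continuous_map euclidean T \<gamma> \<and>
     (\<forall>(U, \<phi>)\<in>\<A>. smooth_on {t. \<gamma> t \<in> U} (\<lambda>t. \<phi> (\<gamma> t)))"


section \<open>Lie groups and their Lie algebras\<close>

locale lie_group = group G
  for G (structure) and T :: "'g topology" and \<A> :: "('g, 'a::euclidean_space) chart set" +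
  assumes smooth_manifold: "smooth_manifold T \<A>"
    and topspace_eq: "topspace T = carrier G"
    and continuous_mult: "continuous_map (prod_topology T T) T (\<lambda>(p, q). p \<otimes> q)"
    and smooth_mult: "\<And>U \<phi> V \<psi> W \<theta>. \<lbrakk>(U, \<phi>) \<in> \<A>; (V, \<psi>) \<in> \<A>; (W, \<theta>) \<in> \<A>\<rbrakk> \<Longrightarrow>
          smooth_on {(x, y). x \<in> \<phi> ` U \<and> y \<in> \<psi> ` V \<and> inv_into U \<phi> x \<otimes> inv_into V \<psi> y \<in> W}
            (\<lambda>(x, y). \<theta> (inv_into U \<phi> x \<otimes> inv_into V \<psi> y))"
    and continuous_inverse: "continuous_map T T (\<lambda>p. m_inv G p)"
    and smooth_inverse: "\<And>U \<phi> V \<psi>. \<lbrakk>(U, \<phi>) \<in> \<A>; (V, \<psi>) \<in> \<A>\<rbrakk> \<Longrightarrow>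
          smooth_on {x \<in> \<phi> ` U. m_inv G (inv_into U \<phi> x) \<in> V}
            (\<lambda>x. \<psi> (m_inv G (inv_into U \<phi> x)))"

text \<open>Smooth vector fields as derivations of the algebra of smooth functions.  Functions on the
  manifold are total on the ambient type; only their values on the manifold matter.\<close>

definition derivation ::
    "('g, 'a::euclidean_space) chart set \<Rightarrow> (('g \<Rightarrow> real) \<Rightarrow> 'g \<Rightarrow> real) \<Rightarrow> bool" where
  "derivation \<A> D \<longleftrightarrow>
     (\<forall>f. smooth_fun \<A> f \<longrightarrow> smooth_fun \<A> (D f)) \<and>
     (\<forall>f h. smooth_fun \<A> f \<longrightarrow> smooth_fun \<A> h \<longrightarrow> (\<forall>p\<in>atlas_space \<A>.
        D (\<lambda>q. f q + h q) p = D f p + D h p \<and>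
        D (\<lambda>q. f q * h q) p = D f p * h p + f p * D h p \<and>
        (\<forall>c. D (\<lambda>q. c * f q) p = c * D f p)))"

definition left_invariant_derivation ::
    "('g, 'b) monoid_scheme \<Rightarrow> ('g, 'a::euclidean_space) chart set \<Rightarrow>
     (('g \<Rightarrow> real) \<Rightarrow> 'g \<Rightarrow> real) \<Rightarrow> bool" where
  "left_invariant_derivation G \<A> D \<longleftrightarrow> derivation \<A> D \<and>
     (\<forall>f. smooth_fun \<A> f \<longrightarrow> (\<forall>g\<in>carrier G. \<forall>p\<in>carrier G.
        D (\<lambda>q. f (g \<otimes>\<^bsub>G\<^esub> q)) p = D f (g \<otimes>\<^bsub>G\<^esub> p)))"

text \<open>The Lie algebra of G is the space of left-invariant vector fields under the commutator.
  It is carried by the vector space 'a (whose own inner product plays no role): X is a linear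
  isomorphism from 'a onto the left-invariant fields, and br is the transported commutator.

  Through X the tangent bundle is trivialised by left translation: the tangent space at p
  consists of the point derivations \<open>\<lambda>f. X u f p\<close> with u in 'a.  Hence, below, a vector field
  is a function from G to 'a, and a vector field along a curve is a function from the real line
  to 'a.\<close>

locale lie_group_with_algebra = lie_group G T \<A>
  for G (structure) and T :: "'g topology" and \<A> :: "('g, 'a::euclidean_space) chart set" +
  fixes X :: "'a \<Rightarrow> ('g \<Rightarrow> real) \<Rightarrow> 'g \<Rightarrow> real"
    and br :: "'a \<Rightarrow> 'a \<Rightarrow> 'a"
  assumes X_left_invariant: "\<And>u. left_invariant_derivation G \<A> (X u)"
    and X_linear: "\<And>u v c f p. \<lbrakk>smooth_fun \<A> f; p \<in> carrier G\<rbrakk> \<Longrightarrow>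
          X (u + v) f p = X u f p + X v f p \<and> X (c *\<^sub>R u) f p = c * X u f p"
    and X_injective: "\<And>u. (\<And>f p. \<lbrakk>smooth_fun \<A> f; p \<in> carrier G\<rbrakk> \<Longrightarrow> X u f p = 0) \<Longrightarrow> u = 0"
    and X_surjective: "\<And>D. left_invariant_derivation G \<A> D \<Longrightarrow>
          \<exists>u. \<forall>f. smooth_fun \<A> f \<longrightarrow> (\<forall>p\<in>carrier G. D f p = X u f p)"
    and X_bracket: "\<And>u v f p. \<lbrakk>smooth_fun \<A> f; p \<in> carrier G\<rbrakk> \<Longrightarrow>
          X (br u v) f p = X u (X v f) p - X v (X u f) p"

definition has_velocity ::
    "('g, 'a::euclidean_space) chart set \<Rightarrow> ('a \<Rightarrow> ('g \<Rightarrow> real) \<Rightarrow> 'g \<Rightarrow> real) \<Rightarrow>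
     (real \<Rightarrow> 'g) \<Rightarrow> (real \<Rightarrow> 'a) \<Rightarrow> bool" where
  "has_velocity \<A> X \<gamma> u \<longleftrightarrow>
     (\<forall>t f. smooth_fun \<A> f \<longrightarrow> ((\<lambda>s. f (\<gamma> s)) has_real_derivative X (u t) f (\<gamma> t)) (at t))"

text \<open>The curve t \<mapsto> exp(tu): the (unique) smooth one-parameter subgroup with initial velocity u.\<close>

definition exp_curve ::
    "('g, 'b) monoid_scheme \<Rightarrow> 'g topology \<Rightarrow> ('g, 'a::euclidean_space) chart set \<Rightarrow>
     ('a \<Rightarrow> ('g \<Rightarrow> real) \<Rightarrow> 'g \<Rightarrow> real) \<Rightarrow> 'a \<Rightarrow> (real \<Rightarrow> 'g) \<Rightarrow> bool" where
  "exp_curve G T \<A> X u \<gamma> \<longleftrightarrow> smooth_curve T \<A> \<gamma> \<and>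
     (\<forall>s t. \<gamma> (s + t) = \<gamma> s \<otimes>\<^bsub>G\<^esub> \<gamma> t) \<and>
     (\<forall>f. smooth_fun \<A> f \<longrightarrow>
        ((\<lambda>t. f (\<gamma> t)) has_real_derivative X u f \<one>\<^bsub>G\<^esub>) (at 0))"


section \<open>Riemannian geometry in the left trivialisation\<close>

definition riemannian_metric ::
    "('g, 'a::euclidean_space) chart set \<Rightarrow> ('g \<Rightarrow> 'a \<Rightarrow> 'a \<Rightarrow> real) \<Rightarrow> bool" where
  "riemannian_metric \<A> m \<longleftrightarrow>
     (\<forall>u v. smooth_fun \<A> (\<lambda>p. m p u v)) \<and>
     (\<forall>p\<in>atlas_space \<A>. bilinear (m p) \<and> (\<forall>u v. m p u v = m p v u) \<and>
        (\<forall>u. u \<noteq> 0 \<longrightarrow> m p u u > 0))"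

text \<open>The Levi-Civita connection: the unique torsion-free metric connection.\<close>

definition levi_civita ::
    "('g, 'a::euclidean_space) chart set \<Rightarrow> ('a \<Rightarrow> ('g \<Rightarrow> real) \<Rightarrow> 'g \<Rightarrow> real) \<Rightarrow>
     ('g \<Rightarrow> 'a \<Rightarrow> 'a \<Rightarrow> real) \<Rightarrow> (('g \<Rightarrow> 'a) \<Rightarrow> ('g \<Rightarrow> 'a) \<Rightarrow> 'g \<Rightarrow> 'a) \<Rightarrow> bool" where
  "levi_civita \<A> X m nab \<longleftrightarrow>
     (\<forall>V W. smooth_fun \<A> V \<longrightarrow> smooth_fun \<A> W \<longrightarrow> smooth_fun \<A> (nab V W)) \<and>
     (\<forall>V W Z h p. smooth_fun \<A> V \<longrightarrow> smooth_fun \<A> W \<longrightarrow> smooth_fun \<A> Z \<longrightarrow>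
        smooth_fun \<A> h \<longrightarrow> p \<in> atlas_space \<A> \<longrightarrow>
        nab (\<lambda>q. V q + W q) Z p = nab V Z p + nab W Z p \<and>
        nab (\<lambda>q. h q *\<^sub>R V q) Z p = h p *\<^sub>R nab V Z p \<and>
        nab V (\<lambda>q. W q + Z q) p = nab V W p + nab V Z p \<and>
        nab V (\<lambda>q. h q *\<^sub>R W q) p = h p *\<^sub>R nab V W p + X (V p) h p *\<^sub>R W p \<and>
        X (nab V W p - nab W V p) h p =
          X (V p) (\<lambda>q. X (W q) h q) p - X (W p) (\<lambda>q. X (V q) h q) p \<and>
        X (V p) (\<lambda>q. m q (W q) (Z q)) p = m p (nab V W p) (Z p) + m p (W p) (nab V Z p))"

text \<open>R(u,v)w at p with R(V,W)Z = \<nabla>V\<nabla>W Z - \<nabla>W\<nabla>V Z - \<nabla>[V,W] Z.  By tensoriality it may be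
  computed on the left-invariant fields through u, v, w, which are the constant functions.\<close>

definition curvature ::
    "('a \<Rightarrow> 'a \<Rightarrow> 'a) \<Rightarrow> (('g \<Rightarrow> 'a) \<Rightarrow> ('g \<Rightarrow> 'a) \<Rightarrow> 'g \<Rightarrow> 'a::euclidean_space) \<Rightarrow>
     'g \<Rightarrow> 'a \<Rightarrow> 'a \<Rightarrow> 'a \<Rightarrow> 'a" where
  "curvature br nab p u v w =
     nab (\<lambda>_. u) (nab (\<lambda>_. v) (\<lambda>_. w)) p - nab (\<lambda>_. v) (nab (\<lambda>_. u) (\<lambda>_. w)) p
     - nab (\<lambda>_. br u v) (\<lambda>_. w) p"

text \<open>The (unique) covariant derivative of vector fields along a curve with velocity u.\<close>

definition covariant_derivative_along ::
    "('g, 'a::euclidean_space) chart set \<Rightarrow> (('g \<Rightarrow> 'a) \<Rightarrow> ('g \<Rightarrow> 'a) \<Rightarrow> 'g \<Rightarrow> 'a) \<Rightarrow>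
     (real \<Rightarrow> 'g) \<Rightarrow> (real \<Rightarrow> 'a) \<Rightarrow> ((real \<Rightarrow> 'a) \<Rightarrow> real \<Rightarrow> 'a) \<Rightarrow> bool" where
  "covariant_derivative_along \<A> nab \<gamma> u D \<longleftrightarrow>
     (\<forall>y. smooth_on UNIV y \<longrightarrow> smooth_on UNIV (D y)) \<and>
     (\<forall>y z h t. smooth_on UNIV y \<longrightarrow> smooth_on UNIV z \<longrightarrow> smooth_on UNIV (h :: real \<Rightarrow> real) \<longrightarrow>
        D (\<lambda>s. y s + z s) t = D y t + D z t \<and>
        D (\<lambda>s. h s *\<^sub>R y s) t = h t *\<^sub>R D y t + deriv h t *\<^sub>R y t) \<and>
     (\<forall>V W t. smooth_fun \<A> V \<longrightarrow> smooth_fun \<A> W \<longrightarrow> V (\<gamma> t) = u t \<longrightarrow>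
        D (\<lambda>s. W (\<gamma> s)) t = nab V W (\<gamma> t))"

text \<open>In the following two definitions u, nab and D are determined by the curve and the metric;
  the existential quantifiers only name them.\<close>

definition geodesic ::
    "'g topology \<Rightarrow> ('g, 'a::euclidean_space) chart set \<Rightarrow>
     ('a \<Rightarrow> ('g \<Rightarrow> real) \<Rightarrow> 'g \<Rightarrow> real) \<Rightarrow> ('g \<Rightarrow> 'a \<Rightarrow> 'a \<Rightarrow> real) \<Rightarrow> (real \<Rightarrow> 'g) \<Rightarrow> bool" where
  "geodesic T \<A> X m \<gamma> \<longleftrightarrow> smooth_curve T \<A> \<gamma> \<and>
     (\<exists>u nab D. has_velocity \<A> X \<gamma> u \<and> levi_civita \<A> X m nab \<and>
        covariant_derivative_along \<A> nab \<gamma> u D \<and> (\<forall>t. D u t = 0))"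

definition jacobi_field ::
    "('g, 'a::euclidean_space) chart set \<Rightarrow> ('a \<Rightarrow> ('g \<Rightarrow> real) \<Rightarrow> 'g \<Rightarrow> real) \<Rightarrow>
     ('a \<Rightarrow> 'a \<Rightarrow> 'a) \<Rightarrow> ('g \<Rightarrow> 'a \<Rightarrow> 'a \<Rightarrow> real) \<Rightarrow> (real \<Rightarrow> 'g) \<Rightarrow> (real \<Rightarrow> 'a) \<Rightarrow> bool" where
  "jacobi_field \<A> X br m \<gamma> y \<longleftrightarrow> smooth_on UNIV y \<and>
     (\<exists>u nab D. has_velocity \<A> X \<gamma> u \<and> levi_civita \<A> X m nab \<and>
        covariant_derivative_along \<A> nab \<gamma> u D \<and>
        (\<forall>t. D (D y) t + curvature br nab (\<gamma> t) (y t) (u t) (u t) = 0))"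

definition has_conjugate_point ::
    "('g, 'a::euclidean_space) chart set \<Rightarrow> ('a \<Rightarrow> ('g \<Rightarrow> real) \<Rightarrow> 'g \<Rightarrow> real) \<Rightarrow>
     ('a \<Rightarrow> 'a \<Rightarrow> 'a) \<Rightarrow> ('g \<Rightarrow> 'a \<Rightarrow> 'a \<Rightarrow> real) \<Rightarrow> (real \<Rightarrow> 'g) \<Rightarrow> bool" where
  "has_conjugate_point \<A> X br m \<gamma> \<longleftrightarrow>
     (\<exists>y. jacobi_field \<A> X br m \<gamma> y \<and> (\<exists>t. y t \<noteq> 0) \<and> y 0 = 0 \<and> (\<exists>t>0. y t = 0))"


section \<open>Linear operators\<close>

definition ordered_basis :: "'a::real_vector list \<Rightarrow> 'a set \<Rightarrow> bool" where
  "ordered_basis bs V \<longleftrightarrow> distinct bs \<and> independent (set bs) \<and> span (set bs) = V"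

text \<open>Column j holds the coordinates of T applied to the j-th basis vector.\<close>

definition matrix_wrt :: "'a::real_vector list \<Rightarrow> ('a \<Rightarrow> 'a) \<Rightarrow> real mat" where
  "matrix_wrt bs T = Matrix.mat (length bs) (length bs)
     (\<lambda>(i, j). representation (set bs) (T (bs ! j)) (bs ! i))"

text \<open>The determinant of an operator on an invariant subspace; independent of the basis chosen.\<close>

definition det_on :: "'a::real_vector set \<Rightarrow> ('a \<Rightarrow> 'a) \<Rightarrow> real" where
  "det_on V T = Determinant.det (matrix_wrt (SOME bs. ordered_basis bs V) T)"

definition diagonalizable_over_complex :: "('a::real_vector \<Rightarrow> 'a) \<Rightarrow> bool" where
  "diagonalizable_over_complex T \<longleftrightarrow>
     (\<exists>bs D. ordered_basis bs UNIV \<and> diagonal_mat D \<and>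
        similar_mat (map_mat complex_of_real (matrix_wrt bs T)) D)"

definition op_trace :: "('a::euclidean_space \<Rightarrow> 'a) \<Rightarrow> real" where
  "op_trace T = (\<Sum>b\<in>Basis. inner (T b) b)"

definition op_exp :: "('a::real_normed_vector \<Rightarrow> 'a) \<Rightarrow> 'a \<Rightarrow> 'a" where
  "op_exp T v = (\<Sum>n. (T ^^ n) v /\<^sub>R fact n)"


section \<open>Lie algebra notions\<close>

definition killing :: "('a \<Rightarrow> 'a \<Rightarrow> 'a) \<Rightarrow> 'a \<Rightarrow> 'a::euclidean_space \<Rightarrow> real" where
  "killing br u v = op_trace (br u \<circ> br v)"

definition lie_ideal :: "('a \<Rightarrow> 'a \<Rightarrow> 'a::real_vector) \<Rightarrow> 'a set \<Rightarrow> bool" where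
  "lie_ideal br I \<longleftrightarrow> subspace I \<and> (\<forall>x. \<forall>y\<in>I. br x y \<in> I)"

definition derived_algebra :: "('a \<Rightarrow> 'a \<Rightarrow> 'a::real_vector) \<Rightarrow> 'a set \<Rightarrow> 'a set" where
  "derived_algebra br I = span {br x y | x y. x \<in> I \<and> y \<in> I}"

definition semisimple_lie_algebra :: "('a \<Rightarrow> 'a \<Rightarrow> 'a::real_vector) \<Rightarrow> bool" where
  "semisimple_lie_algebra br \<longleftrightarrow>
     (\<forall>I. lie_ideal br I \<and> (\<exists>n. (derived_algebra br ^^ n) I = {0}) \<longrightarrow> I = {0})"

definition centralizer :: "('a \<Rightarrow> 'a \<Rightarrow> 'a::real_vector) \<Rightarrow> 'a \<Rightarrow> 'a set" where
  "centralizer br u = {v. br u v = 0}"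

definition regular_element :: "('a \<Rightarrow> 'a \<Rightarrow> 'a::real_vector) \<Rightarrow> 'a \<Rightarrow> bool" where
  "regular_element br u \<longleftrightarrow> (\<forall>v. dim (centralizer br u) \<le> dim (centralizer br v))"

definition semisimple_element :: "('a \<Rightarrow> 'a \<Rightarrow> 'a::real_vector) \<Rightarrow> 'a \<Rightarrow> bool" where
  "semisimple_element br u \<longleftrightarrow> diagonalizable_over_complex (br u)"

definition killing_perp :: "('a \<Rightarrow> 'a \<Rightarrow> 'a::euclidean_space) \<Rightarrow> 'a set \<Rightarrow> 'a set" where
  "killing_perp br C = {v. \<forall>w\<in>C. killing br v w = 0}"

definition left_invariant_metric ::
    "('a \<Rightarrow> 'a \<Rightarrow> 'a::euclidean_space) \<Rightarrow> ('a \<Rightarrow> 'a) \<Rightarrow> 'g \<Rightarrow> 'a \<Rightarrow> 'a \<Rightarrow> real" where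
  "left_invariant_metric br \<Lambda> = (\<lambda>p u v. killing br u (\<Lambda> v))"

text \<open>The Euler-Arnold equation u' = ad(u)* u, where * is the adjoint with respect to the inner
  product \<open>\<langle>v,w\<rangle> = \<kappa>(v,\<Lambda>w)\<close>; equivalently \<open>\<Lambda>u' = [\<Lambda>u,u]\<close>.\<close>

definition euler_arnold ::
    "('a \<Rightarrow> 'a \<Rightarrow> 'a::euclidean_space) \<Rightarrow> ('a \<Rightarrow> 'a) \<Rightarrow> (real \<Rightarrow> 'a) \<Rightarrow> bool" where
  "euler_arnold br \<Lambda> u \<longleftrightarrow>
     (\<forall>t. \<exists>a. (u has_vector_derivative a) (at t) \<and>
        (\<forall>w. killing br a (\<Lambda> w) = killing br (u t) (\<Lambda> (br (u t) w))))"

end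

theory Submission
  imports Defs
begin

text \<open>Since \<open>\<Lambda>\<close> preserves \<open>C(u\<^sub>0)\<close> and \<open>\<kappa>(v, \<Lambda>v) > 0\<close>, the Killing form is nondegenerate on \<open>C(u\<^sub>0)\<close>,
  so the Lie algebra is \<open>C(u\<^sub>0) \<oplus> \<Omega>\<close> with \<open>A = ad(u\<^sub>0)\<close> invertible on \<open>\<Omega>\<close>.  Perturbing \<open>u\<^sub>0\<close> inside
  \<open>C(u\<^sub>0)\<close> shows that this centralizer is abelian, and regularity of \<open>\<Lambda>u\<^sub>0\<close> then gives
  \<open>C(\<Lambda>u\<^sub>0) = C(u\<^sub>0)\<close>; hence \<open>B = ad(\<Lambda>u\<^sub>0)\<close> is invertible on \<open>\<Omega>\<close> and commutes with \<open>A\<close>.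

  In the left trivialisation the Levi-Civita connection is constant-coefficient, and the Jacobi
  equation along \<open>exp(tu\<^sub>0)\<close> factors as \<open>(d/dt - F)(d/dt + A) y = 0\<close>.  It is solved by
  \<open>y(t) = B\<^sup>-\<^sup>1 (e\<^sup>t\<^sup>G - e\<^sup>-\<^sup>t\<^sup>A) z\<close> with \<open>G = \<Lambda>F\<Lambda>\<^sup>-\<^sup>1\<close>, which vanishes at 0, and at \<open>\<tau>\<close> as soon as
  \<open>z\<close> is a null vector of \<open>e\<^sup>\<tau>\<^sup>G - e\<^sup>-\<^sup>\<tau>\<^sup>A\<close>.\<close>

section \<open>Calculus of smooth maps\<close>

text \<open>A derivative at a point is determined by values nearby, so on an open set agreement of
  \<open>f\<close> and \<open>g\<close> passes to their directional derivatives and the induction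
  can continue.\<close>

lemma Ck_on_cong:
  assumes "open S" "\<And>x. x \<in> S \<Longrightarrow> f x = g x" "Ck_on k S f"
  shows "Ck_on k S g"
  using assms(2,3)
proof (induction k arbitrary: f g)
  case 0
  then show ?case using continuous_on_eq by fastforce
next
  case (Suc k)
  have g': "(g has_derivative frechet_derivative f (at x)) (at x)" if "x \<in> S" for x
  proof (rule has_derivative_transform_within_open[OF _ assms(1) that])
    show "(f has_derivative frechet_derivative f (at x)) (at x)"
      using Suc.prems(2) that frechet_derivative_works by auto
  qed (use Suc.prems in auto)
  have eq: "frechet_derivative f (at x) = frechet_derivative g (at x)" if "x \<in> S" for x
    using g'[OF that] frechet_derivative_at by blast
  have "Ck_on k S (\<lambda>x. frechet_derivative g (at x) v)" for v
    by (rule Suc.IH[of "\<lambda>x. frechet_derivative f (at x) v"]) (use Suc.prems(2) eq in simp_all)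
  moreover have "\<forall>x\<in>S. g differentiable at x"
    using g' differentiable_def by blast
  ultimately show ?case by simp
qed

text \<open>Allows an explicit derivative \<open>f'\<close> to be exhibited in place of
  \<open>frechet_derivative\<close>. Uniqueness of derivatives identifies the two on
  \<open>S\<close>, and \<open>Ck_on_cong\<close> transfers the regularity.\<close>

lemma Ck_on_SucI:
  assumes "open S" "\<And>x. x \<in> S \<Longrightarrow> (f has_derivative f' x) (at x)"
    and "\<And>v. Ck_on k S (\<lambda>x. f' x v)"
  shows "Ck_on (Suc k) S f"
proof -
  have "Ck_on k S (\<lambda>x. frechet_derivative f (at x) v)" for v
    by (rule Ck_on_cong[OF assms(1) _ assms(3)[of v]]) (simp add: frechet_derivative_at[OF assms(2), symmetric])
  moreover have "\<forall>x\<in>S. f differentiable at x"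
    using assms(2) differentiable_def by blast
  ultimately show ?thesis by simp
qed

lemma Ck_on_Suc_has_derivative:
  assumes "Ck_on (Suc k) S f" "x \<in> S"
  shows "(f has_derivative frechet_derivative f (at x)) (at x)"
  using assms frechet_derivative_works by auto

lemma Ck_on_SucD: "Ck_on (Suc k) S f \<Longrightarrow> Ck_on k S f"
proof (induction k arbitrary: f)
  case 0
  then show ?case
    by (auto intro!: continuous_at_imp_continuous_on differentiable_imp_continuous_within)
qed auto

lemma Ck_on_local:
  assumes "\<And>x. x \<in> S \<Longrightarrow> \<exists>U. open U \<and> x \<in> U \<and> Ck_on k U f"
  shows "Ck_on k S f"
  using assms
proof (induction k arbitrary: f)
  case 0
  then have "isCont f x" if "x \<in> S" for x
    using that continuous_on_eq_continuous_at by fastforce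
  then show ?case by (simp add: continuous_at_imp_continuous_on)
next
  case (Suc k)
  then show ?case by simp metis
qed

lemma Ck_on_const: "open S \<Longrightarrow> Ck_on k S (\<lambda>x. c)"
  by (induction k arbitrary: c) simp_all

lemma Ck_on_linear:
  assumes "bounded_linear L" "open S" "Ck_on k S f"
  shows "Ck_on k S (\<lambda>x. L (f x))"
  using assms(3)
proof (induction k arbitrary: f)
  case 0
  then show ?case using bounded_linear.continuous_on[OF assms(1)] by auto
next
  case (Suc k)
  show ?case
  proof (rule Ck_on_SucI[OF assms(2)])
    show "((\<lambda>x. L (f x)) has_derivative (\<lambda>v. L (frechet_derivative f (at x) v))) (at x)"
      if "x \<in> S" for x
      using bounded_linear.has_derivative[OF assms(1)] Ck_on_Suc_has_derivative[OF Suc.prems that]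
      by blast
    show "Ck_on k S (\<lambda>x. L (frechet_derivative f (at x) v))" for v
      using Suc by auto
  qed
qed

lemma Ck_on_add:
  assumes "open S" "Ck_on k S f" "Ck_on k S g"
  shows "Ck_on k S (\<lambda>x. f x + g x)"
  using assms(2,3)
proof (induction k arbitrary: f g)
  case 0
  then show ?case by (auto intro: continuous_intros)
next
  case (Suc k)
  then show ?case
    by (intro Ck_on_SucI[OF assms(1), where f' = "\<lambda>x v. frechet_derivative f (at x) v
        + frechet_derivative g (at x) v"])
      (auto intro!: has_derivative_add Ck_on_Suc_has_derivative)
qed

lemma Ck_on_sum:
  assumes "open S" "finite I" "\<And>i. i \<in> I \<Longrightarrow> Ck_on k S (f i)"
  shows "Ck_on k S (\<lambda>x. \<Sum>i\<in>I. f i x)"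
  using assms(2,3)
  by (induction I rule: finite_induct) (auto intro: Ck_on_const Ck_on_add assms(1))

text \<open>The product rule gives two terms of the same bilinear shape, each with one factor
  differentiated. The undifferentiated factor is only known at order \<open>Suc k\<close>, so
  \<open>Ck_on_SucD\<close> lowers it before the induction hypothesis applies.\<close>

lemma Ck_on_bilinear:
  assumes "bounded_bilinear P" "open S" "Ck_on k S f" "Ck_on k S g"
  shows "Ck_on k S (\<lambda>x. P (f x) (g x))"
  using assms(3,4)
proof (induction k arbitrary: f g)
  case 0
  then show ?case using bounded_bilinear.continuous_on[OF assms(1)] by auto
next
  case (Suc k)
  show ?case
  proof (rule Ck_on_SucI[OF assms(2)])
    show "((\<lambda>x. P (f x) (g x)) has_derivative (\<lambda>v. P (f x) (frechet_derivative g (at x) v)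
        + P (frechet_derivative f (at x) v) (g x))) (at x)" if "x \<in> S" for x
      using bounded_bilinear.FDERIV[OF assms(1) Ck_on_Suc_has_derivative[OF Suc.prems(1) that]
          Ck_on_Suc_has_derivative[OF Suc.prems(2) that]] .
    show "Ck_on k S (\<lambda>x. P (f x) (frechet_derivative g (at x) v)
        + P (frechet_derivative f (at x) v) (g x))" for v
      using Suc.prems Suc.prems[THEN Ck_on_SucD] by (intro Ck_on_add Suc.IH assms(2)) simp_all
  qed
qed

text \<open>The chain rule yields an operator depending on x, applied to a vector depending on x.
  Expanding that vector in the basis of the middle space leaves finitely many products of a scalar
  function with a composition \<open>D f b\<close> after \<open>g\<close>, and the induction
  hypothesis covers those.\<close>

lemma Ck_on_compose:
  fixes g :: "'x::real_normed_vector \<Rightarrow> 'y::euclidean_space"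
  assumes "open S" "Ck_on k S g" "Ck_on k W f" "g ` S \<subseteq> W"
  shows "Ck_on k S (\<lambda>x. f (g x))"
  using assms(2,3)
proof (induction k arbitrary: f)
  case 0
  then show ?case using continuous_on_compose2[of W f S g] assms(4) by auto
next
  case (Suc k)
  have lin: "linear (frechet_derivative f (at (g x)))" if "x \<in> S" for x
    using Ck_on_Suc_has_derivative[OF Suc.prems(2)] assms(4) that
    by (meson has_derivative_linear image_subset_iff)
  show ?case
  proof (rule Ck_on_SucI[OF assms(1)])
    show "((\<lambda>x. f (g x)) has_derivative (\<lambda>v. \<Sum>b\<in>Basis. inner (frechet_derivative g (at x) v) b *\<^sub>R
        frechet_derivative f (at (g x)) b)) (at x)" if "x \<in> S" for x
    proof -
      have "((\<lambda>x. f (g x)) has_derivative (\<lambda>v. frechet_derivative f (at (g x))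
          (frechet_derivative g (at x) v))) (at x)"
        using has_derivative_compose[OF Ck_on_Suc_has_derivative[OF Suc.prems(1) that]
            Ck_on_Suc_has_derivative[OF Suc.prems(2)]] assms(4) that by blast
      moreover have "frechet_derivative f (at (g x)) w =
          (\<Sum>b\<in>Basis. inner w b *\<^sub>R frechet_derivative f (at (g x)) b)" for w
        using linear_sum[OF lin[OF that], of "\<lambda>b. inner w b *\<^sub>R b" Basis]
        unfolding linear_scale[OF lin[OF that]] euclidean_representation .
      ultimately show ?thesis
        by (blast intro: has_derivative_eq_rhs ext)
    qed
    show "Ck_on k S (\<lambda>x. \<Sum>b\<in>Basis. inner (frechet_derivative g (at x) v) b *\<^sub>R
        frechet_derivative f (at (g x)) b)" for v
    proof (intro Ck_on_sum Ck_on_bilinear[OF bounded_bilinear_scaleR] assms(1) finite_Basis)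
      fix b :: 'y
      show "Ck_on k S (\<lambda>x. inner (frechet_derivative g (at x) v) b)"
        using Suc.prems by (intro Ck_on_linear[OF bounded_linear_inner_left] assms(1)) auto
      show "Ck_on k S (\<lambda>x. frechet_derivative f (at (g x)) b)"
        using Suc.prems(2) by (intro Suc.IH Ck_on_SucD[OF Suc.prems(1)]) simp
    qed
  qed
qed

lemma smooth_on_const: "open S \<Longrightarrow> smooth_on S (\<lambda>x. c)"
  by (simp add: smooth_on_def Ck_on_const)

lemma smooth_on_cong:
  "open S \<Longrightarrow> (\<And>x. x \<in> S \<Longrightarrow> f x = g x) \<Longrightarrow> smooth_on S f \<Longrightarrow> smooth_on S g"
  unfolding smooth_on_def using Ck_on_cong by blast

lemma smooth_on_linear:
  "bounded_linear L \<Longrightarrow> open S \<Longrightarrow> smooth_on S f \<Longrightarrow> smooth_on S (\<lambda>x. L (f x))"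
  by (simp add: smooth_on_def Ck_on_linear)

lemma smooth_on_add:
  "open S \<Longrightarrow> smooth_on S f \<Longrightarrow> smooth_on S g \<Longrightarrow> smooth_on S (\<lambda>x. f x + g x)"
  by (simp add: smooth_on_def Ck_on_add)

lemma smooth_on_bilinear:
  "bounded_bilinear P \<Longrightarrow> open S \<Longrightarrow> smooth_on S f \<Longrightarrow> smooth_on S g \<Longrightarrow>
    smooth_on S (\<lambda>x. P (f x) (g x))"
  by (simp add: smooth_on_def Ck_on_bilinear)

lemma smooth_on_compose:
  fixes g :: "'x::real_normed_vector \<Rightarrow> 'y::euclidean_space"
  assumes "open S" "smooth_on S g" "smooth_on W f" "g ` S \<subseteq> W"
  shows "smooth_on S (\<lambda>x. f (g x))"
  using assms Ck_on_compose unfolding smooth_on_def by blast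

lemma smooth_on_local:
  assumes "\<And>x. x \<in> S \<Longrightarrow> \<exists>U. open U \<and> x \<in> U \<and> smooth_on U f"
  shows "smooth_on S f"
  using assms Ck_on_local unfolding smooth_on_def by metis

text \<open>Embeds a slice of a product, so that one factor of the group multiplication can be
  frozen. The derivative is constant in x.\<close>

lemma smooth_on_Pair:
  fixes c :: "'y::real_normed_vector"
  assumes "open S"
  shows "smooth_on S (\<lambda>x. (c, x))"
  unfolding smooth_on_def
proof
  fix k
  show "Ck_on k S (\<lambda>x. (c, x))"
  proof (cases k)
    case 0
    then show ?thesis by (auto intro: continuous_intros)
  next
    case (Suc j)
    have "((\<lambda>x. (c, x)) has_derivative (\<lambda>v. (0, v))) (at x)" for x
      by (auto intro: derivative_eq_intros)
    then show ?thesis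
      unfolding Suc using assms by (intro Ck_on_SucI[where f' = "\<lambda>x v. (0, v)"] Ck_on_const) auto
  qed
qed

section \<open>Invariant inner products and centralizers\<close>

text \<open>Injectivity preserves dimension, so the image is a subspace of \<open>V\<close> of full
  dimension.\<close>

lemma linear_inj_imp_bij_betw_subspace:
  fixes f :: "'a::euclidean_space \<Rightarrow> 'a"
  assumes "linear f" "subspace V" "f ` V \<subseteq> V" "\<And>x. x \<in> V \<Longrightarrow> f x = 0 \<Longrightarrow> x = 0"
  shows "bij_betw f V V"
proof -
  have inj: "inj_on f V"
    using assms by (intro linear_inj_on_iff_eq_0[THEN iffD2]) auto
  then have "dim (f ` V) = dim V"
    using dim_image_eq[OF assms(1), of V] span_eq_iff[THEN iffD2, OF assms(2)] by simp
  then have "f ` V = V"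
    using subspace_dim_equal[OF linear_subspace_image[OF assms(1,2)] assms(2,3)] by simp
  with inj show ?thesis by (simp add: bij_betw_def)
qed

lemma op_trace_comp_commute:
  fixes S T :: "'a::euclidean_space \<Rightarrow> 'a"
  assumes "linear S" "linear T"
  shows "op_trace (S \<circ> T) = op_trace (T \<circ> S)"
proof -
  have expand: "op_trace (S \<circ> T) = (\<Sum>b\<in>Basis. \<Sum>c\<in>Basis. inner (T b) c * inner (S c) b)"
    if "linear S" for S T :: "'a \<Rightarrow> 'a"
  proof -
    have "inner (S (T b)) b = (\<Sum>c\<in>Basis. inner (T b) c * inner (S c) b)" for b
    proof -
      have "S (T b) = S (\<Sum>c\<in>Basis. inner (T b) c *\<^sub>R c)"
        by (simp add: euclidean_representation)
      also have "\<dots> = (\<Sum>c\<in>Basis. inner (T b) c *\<^sub>R S c)"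
        by (simp add: linear_sum[OF that] linear_scale[OF that])
      finally show ?thesis
        by (simp add: inner_sum_left)
    qed
    then show ?thesis by (simp add: op_trace_def)
  qed
  show ?thesis
    unfolding expand[OF assms(1)] expand[OF assms(2)]
    by (subst sum.swap) (simp add: mult.commute)
qed

lemma op_trace_diff: "op_trace (\<lambda>x. S x - T x) = op_trace S - op_trace T"
  by (simp add: op_trace_def inner_diff_left sum_subtractf)

section \<open>Real Lie algebras and invariance of the Killing form\<close>

locale real_lie_algebra =
  fixes br :: "'a::euclidean_space \<Rightarrow> 'a \<Rightarrow> 'a"
  assumes bilinear_br: "bilinear br"
    and br_self [simp]: "br u u = 0"
    and jacobi: "br u (br v w) = br (br u v) w + br v (br u w)"
begin

lemmas br_simps = bilinear_ladd[OF bilinear_br] bilinear_radd[OF bilinear_br]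
  bilinear_lmul[OF bilinear_br] bilinear_rmul[OF bilinear_br]
  bilinear_lneg[OF bilinear_br] bilinear_rneg[OF bilinear_br]
  bilinear_lzero[OF bilinear_br] bilinear_rzero[OF bilinear_br]
  bilinear_lsub[OF bilinear_br] bilinear_rsub[OF bilinear_br]

lemma linear_br: "linear (br u)"
  using bilinear_br by (simp add: bilinear_def)

lemma br_swap: "br u v = - br v u"
  using br_self[of "u + v"] unfolding br_simps by (simp add: eq_neg_iff_add_eq_0 add.commute)

lemma bilinear_killing: "bilinear (killing br)"
  by (auto simp: bilinear_def linear_iff killing_def op_trace_def br_simps inner_add_left
      sum.distrib sum_distrib_left)

lemmas killing_simps = bilinear_ladd[OF bilinear_killing] bilinear_radd[OF bilinear_killing]
  bilinear_lmul[OF bilinear_killing] bilinear_rmul[OF bilinear_killing]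
  bilinear_lneg[OF bilinear_killing] bilinear_rneg[OF bilinear_killing]
  bilinear_lzero[OF bilinear_killing] bilinear_rzero[OF bilinear_killing]
  bilinear_lsub[OF bilinear_killing] bilinear_rsub[OF bilinear_killing]

text \<open>With ad[x,y] written as the commutator of ad x and ad y, both sides become differences
  of traces of triple products, and these agree by cyclicity of the trace.\<close>

lemma killing_assoc: "killing br (br u v) w = killing br u (br v w)"
proof -
  have ad: "br (br x y) = (\<lambda>z. br x (br y z) - br y (br x z))" for x y
    using jacobi[of x y] by auto
  have "op_trace (br u \<circ> (br w \<circ> br v)) = op_trace ((br w \<circ> br v) \<circ> br u)"
    "op_trace (br v \<circ> (br u \<circ> br w)) = op_trace ((br u \<circ> br w) \<circ> br v)"
    by (intro op_trace_comp_commute linear_compose linear_br)+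
  then show ?thesis
    unfolding killing_def ad comp_def
    by (simp add: op_trace_diff linear_diff[OF linear_br])
qed

lemma killing_skew: "killing br (br u v) w = - killing br v (br u w)"
  using killing_assoc[of v u w] br_swap[of u v] by (simp add: killing_simps)

lemma mem_centralizer: "v \<in> centralizer br u \<longleftrightarrow> br u v = 0"
  by (simp add: centralizer_def)

lemma subspace_centralizer: "subspace (centralizer br u)"
  by (auto simp: centralizer_def subspace_def br_simps)

lemma subspace_killing_perp: "subspace (killing_perp br C)"
  by (auto simp: killing_perp_def subspace_def killing_simps)

lemma br_mem_killing_perp:
  assumes "\<And>c. c \<in> C \<Longrightarrow> br u c \<in> C" "v \<in> killing_perp br C"
  shows "br u v \<in> killing_perp br C"
  using assms by (auto simp: killing_perp_def killing_skew)

text \<open>Skewness of ad u makes its range orthogonal to its kernel. As \<open>v\<close> is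
  arbitrary, this also puts brackets of vectors outside the complement into the complement.\<close>

lemma range_br_subset_killing_perp: "br u v \<in> killing_perp br (centralizer br u)"
  by (simp add: killing_perp_def killing_skew centralizer_def killing_simps)

end

section \<open>Left-invariant metrics and their connection coefficients\<close>

locale metric_lie_algebra = real_lie_algebra br
  for br :: "'a::euclidean_space \<Rightarrow> 'a \<Rightarrow> 'a" +
  fixes \<Lambda> :: "'a \<Rightarrow> 'a"
  assumes linear_\<Lambda>: "linear \<Lambda>"
    and bij_\<Lambda>: "bij \<Lambda>"
    and killing_\<Lambda>: "killing br u (\<Lambda> v) = killing br (\<Lambda> u) v"
    and killing_\<Lambda>_pos: "u \<noteq> 0 \<Longrightarrow> killing br u (\<Lambda> u) > 0"
begin

abbreviation \<Lambda>i where "\<Lambda>i \<equiv> inv_into UNIV \<Lambda>"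

lemma \<Lambda>_inverse [simp]: "\<Lambda> (\<Lambda>i v) = v" "\<Lambda>i (\<Lambda> v) = v"
  using bij_\<Lambda> by (simp_all add: bij_is_surj surj_f_inv_f bij_is_inj)

lemma linear_\<Lambda>i: "linear \<Lambda>i"
  by (metis linear_\<Lambda> bij_\<Lambda> bij_is_inj bij_is_surj inj_linear_imp_inv_linear)

lemmas \<Lambda>_simps = linear_add[OF linear_\<Lambda>] linear_diff[OF linear_\<Lambda>] linear_scale[OF linear_\<Lambda>]
  linear_neg[OF linear_\<Lambda>] linear_0[OF linear_\<Lambda>]
  linear_add[OF linear_\<Lambda>i] linear_diff[OF linear_\<Lambda>i] linear_scale[OF linear_\<Lambda>i]
  linear_neg[OF linear_\<Lambda>i] linear_0[OF linear_\<Lambda>i]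

text \<open>The Koszul formula evaluated on left-invariant fields.\<close>

definition lc_coeff :: "'a \<Rightarrow> 'a \<Rightarrow> 'a" where
  "lc_coeff u v = (1 / 2) *\<^sub>R (br u v + \<Lambda>i (br u (\<Lambda> v) - br (\<Lambda> u) v))"

lemma bilinear_lc_coeff: "bilinear lc_coeff"
  by (auto simp: bilinear_def linear_iff lc_coeff_def br_simps \<Lambda>_simps algebra_simps)

text \<open>The \<open>\<Lambda>i\<close> part is symmetric in u and v and cancels, leaving twice
  half the bracket.\<close>

lemma lc_coeff_torsion: "lc_coeff u v - lc_coeff v u = br u v"
proof -
  have "br v u = - br u v" "br v (\<Lambda> u) = - br (\<Lambda> u) v" "br (\<Lambda> v) u = - br u (\<Lambda> v)"
    by (rule br_swap)+
  then have "lc_coeff u v - lc_coeff v u = (1 / 2) *\<^sub>R (br u v + br u v)"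
    unfolding lc_coeff_def by (simp add: \<Lambda>_simps algebra_simps)
  then show ?thesis
    by (simp flip: scaleR_2)
qed

text \<open>Metric compatibility on left-invariant fields, whose inner products are constant. Once
  \<open>\<Lambda>\<close> and \<open>\<Lambda>i\<close> are moved across by symmetry, the six terms
  cancel in three pairs by skewness of ad.\<close>

lemma lc_coeff_metric: "killing br (lc_coeff u v) (\<Lambda> w) + killing br v (\<Lambda> (lc_coeff u w)) = 0"
proof -
  have "killing br (\<Lambda>i x) (\<Lambda> w) = killing br x w" "killing br v (\<Lambda> x) = killing br (\<Lambda> v) x" for x
    by (simp_all add: killing_\<Lambda>)
  then show ?thesis
    using killing_\<Lambda>[of v "\<Lambda>i (br u (\<Lambda> w))"] killing_\<Lambda>[of v "\<Lambda>i (br (\<Lambda> u) w)"]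
    by (simp add: lc_coeff_def killing_simps \<Lambda>_simps killing_skew algebra_simps)
qed

end

section \<open>The splitting of the Lie algebra along the centralizer of a steady element\<close>

locale steady_element = metric_lie_algebra br \<Lambda>
  for br :: "'a::euclidean_space \<Rightarrow> 'a \<Rightarrow> 'a" and \<Lambda> +
  fixes u :: 'a
  assumes \<Lambda>_centralizer: "\<Lambda> ` centralizer br u \<subseteq> centralizer br u"
begin

abbreviation C where "C \<equiv> centralizer br u"
abbreviation \<Omega> where "\<Omega> \<equiv> killing_perp br C"

lemma br_\<Lambda>_eq_0: "br u (\<Lambda> u) = 0"
  using \<Lambda>_centralizer mem_centralizer[of _ u] br_self[of u] by blast

text \<open>Symmetry of \<open>\<Lambda>\<close> and invariance of the Killing form turn the right
  side of the weak equation into the pairing of [\<Lambda>u, u] = 0 with w, so the velocity 0 solves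
  it.\<close>

lemma steady: "euler_arnold br \<Lambda> (\<lambda>t. u)"
  unfolding euler_arnold_def
proof (intro allI exI conjI)
  fix w
  have "killing br u (\<Lambda> (br u w)) = killing br (br (\<Lambda> u) u) w"
    by (simp add: killing_\<Lambda> killing_assoc)
  then show "killing br 0 (\<Lambda> w) = killing br u (\<Lambda> (br u w))"
    using br_\<Lambda>_eq_0 br_swap[of "\<Lambda> u" u] by (simp add: killing_simps)
qed simp

text \<open>For v in the intersection, \<open>\<Lambda> v\<close> lies in \<open>C\<close> and so
  pairs to 0 with v, against positivity. The Killing form may be indefinite, so positivity of the
  metric does the work here.\<close>

lemma centralizer_perp_trivial: "v \<in> C \<Longrightarrow> v \<in> \<Omega> \<Longrightarrow> v = 0"
  using \<Lambda>_centralizer killing_\<Lambda>_pos[of v] unfolding killing_perp_def by force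

lemma bij_br_perp: "bij_betw (br u) \<Omega> \<Omega>"
proof (rule linear_inj_imp_bij_betw_subspace[OF linear_br subspace_killing_perp])
  show "br u ` \<Omega> \<subseteq> \<Omega>"
    using range_br_subset_killing_perp by blast
  show "v = 0" if "v \<in> \<Omega>" "br u v = 0" for v
    using centralizer_perp_trivial that mem_centralizer by blast
qed

text \<open>Since ad u is onto \<Omega> already from \<Omega>, some w there has the same bracket
  with u as v does; the remainder v - w then commutes with u.\<close>

lemma centralizer_perp_decompose:
  obtains c w where "c \<in> C" "w \<in> \<Omega>" "v = c + w"
proof -
  obtain w where "w \<in> \<Omega>" "br u w = br u v"
    using bij_br_perp range_br_subset_killing_perp[of u v] unfolding bij_betw_def
    by (metis imageE)
  then show ?thesis
    using that[of "v - w" w] by (simp add: centralizer_def br_simps)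
qed

lemma \<Lambda>_perp: "v \<in> \<Omega> \<Longrightarrow> \<Lambda> v \<in> \<Omega>"
  using \<Lambda>_centralizer by (auto simp: killing_perp_def simp flip: killing_\<Lambda>)

lemma bij_\<Lambda>_perp: "bij_betw \<Lambda> \<Omega> \<Omega>"
  by (rule linear_inj_imp_bij_betw_subspace[OF linear_\<Lambda> subspace_killing_perp])
    (use \<Lambda>_perp in \<open>auto, metis \<Lambda>_inverse(2) linear_0 linear_\<Lambda>i\<close>)

lemma \<Lambda>i_perp: "v \<in> \<Omega> \<Longrightarrow> \<Lambda>i v \<in> \<Omega>"
  using bij_\<Lambda>_perp unfolding bij_betw_def by (metis \<Lambda>_inverse(2) imageE)

lemma br_centralizer: "y \<in> C \<Longrightarrow> c \<in> C \<Longrightarrow> br y c \<in> C"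
  using jacobi[of u y c] by (simp add: centralizer_def br_simps)

lemma br_centralizer_perp: "y \<in> C \<Longrightarrow> w \<in> \<Omega> \<Longrightarrow> br y w \<in> \<Omega>"
  using br_mem_killing_perp br_centralizer by blast

text \<open>For small \<open>\<epsilon> > 0\<close> the operator \<open>ad(u + \<epsilon>y)\<close> is still injective on \<open>\<Omega>\<close>, so its kernel lies
  in \<open>C(u)\<close>, where it acts as \<open>\<epsilon> ad(y)\<close>; regularity of \<open>u\<close> then forces \<open>ad(y)\<close> to vanish there.\<close>

lemma centralizer_abelian:
  assumes "regular_element br u" "y \<in> C" "c \<in> C"
  shows "br y c = 0"
proof -
  obtain e where e: "e > 0" "\<And>w. w \<in> \<Omega> \<Longrightarrow> norm (br u w) \<ge> e * norm w"
    using injective_imp_isometric[OF closed_subspace[OF subspace_killing_perp]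
        subspace_killing_perp linear_conv_bounded_linear[THEN iffD1, OF linear_br]]
      centralizer_perp_trivial mem_centralizer by metis
  obtain K where K: "K > 0" "\<And>w. norm (br y w) \<le> K * norm w"
    using linear_bounded_pos[OF linear_br] by blast
  \<comment> \<open>On \<Omega>, ad u stretches by at least \<open>e\<close>, while ad y stretches
    by at most \<open>K\<close>. This choice keeps the perturbation \<epsilon> ad y strictly below
    that lower bound.\<close>
  define \<epsilon> where "\<epsilon> = e / (2 * K)"
  have \<epsilon>: "\<epsilon> > 0" "\<epsilon> * K < e"
    using e(1) K(1) by (auto simp: \<epsilon>_def field_simps)
  have br_eq: "br (u + \<epsilon> *\<^sub>R y) v = br u v + \<epsilon> *\<^sub>R br y v" for v
    by (simp add: br_simps)
  have sub: "centralizer br (u + \<epsilon> *\<^sub>R y) \<subseteq> C"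
  proof
    fix v assume v: "v \<in> centralizer br (u + \<epsilon> *\<^sub>R y)"
    obtain d w where dw: "d \<in> C" "w \<in> \<Omega>" "v = d + w"
      by (rule centralizer_perp_decompose)
    \<comment> \<open>\<open>z\<close> is the \<Omega>-component of the vanishing bracket of u +
      \<epsilon>y with v; the other component \<epsilon>[y,d] lies in \<open>C\<close>. Their sum is
      0, so \<open>z\<close> is in both spaces and vanishes.\<close>
    define z where "z = br u w + \<epsilon> *\<^sub>R br y w"
    have "z \<in> \<Omega>"
      unfolding z_def using subspace_killing_perp br_centralizer_perp[OF assms(2) dw(2)]
      by (intro subspace_add subspace_scale range_br_subset_killing_perp)
    have "\<epsilon> *\<^sub>R br y d + z = 0"
      using v dw unfolding z_def centralizer_def by (simp add: br_simps algebra_simps)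
    then have "z = - (\<epsilon> *\<^sub>R br y d)"
      by (simp add: eq_neg_iff_add_eq_0 add.commute)
    then have "z \<in> C"
      using subspace_centralizer br_centralizer[OF assms(2) dw(1)]
      by (simp add: subspace_neg subspace_scale)
    with \<open>z \<in> \<Omega>\<close> have "z = 0"
      by (intro centralizer_perp_trivial)
    then have "norm (br u w) = \<epsilon> * norm (br y w)"
      using \<epsilon>(1) unfolding z_def by (simp add: add_eq_0_iff2)
    also have "\<dots> \<le> \<epsilon> * (K * norm w)"
      using K(2) \<epsilon>(1) by (intro mult_left_mono) auto
    finally have "e * norm w \<le> \<epsilon> * K * norm w"
      using e(2)[OF dw(2)] by (simp add: mult.assoc)
    then have "w = 0"
      using \<epsilon>(2) by (metis mult_le_cancel_right_pos not_less zero_less_norm_iff)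
    then show "v \<in> C" using dw by simp
  qed
  \<comment> \<open>Regularity of u excludes a smaller dimension, so the inclusion is an
    equality.\<close>
  then have "centralizer br (u + \<epsilon> *\<^sub>R y) = C"
    using assms(1) subspace_dim_equal[OF subspace_centralizer subspace_centralizer]
    unfolding regular_element_def by blast
  then have "br (u + \<epsilon> *\<^sub>R y) c = 0"
    using assms(3) by (auto simp: centralizer_def)
  then show ?thesis
    using \<epsilon>(1) assms(3) by (simp add: br_eq centralizer_def)
qed

text \<open>Both u and \<Lambda>u lie in the abelian \<open>C\<close>, so \<open>C\<close> is
  contained in the centralizer of \<Lambda>u. Regularity of \<Lambda>u bounds the dimension of that
  centralizer by that of \<open>C\<close>.\<close>

lemma centralizer_\<Lambda>_eq:
  assumes "regular_element br u" "regular_element br (\<Lambda> u)"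
  shows "centralizer br (\<Lambda> u) = C"
proof -
  have "u \<in> C" by (simp add: centralizer_def)
  then have "C \<subseteq> centralizer br (\<Lambda> u)"
    using centralizer_abelian[OF assms(1)] \<Lambda>_centralizer mem_centralizer by blast
  then show ?thesis
    using assms(2) subspace_dim_equal[OF subspace_centralizer subspace_centralizer]
    unfolding regular_element_def by metis
qed

lemma bij_br_\<Lambda>_perp:
  assumes "regular_element br u" "regular_element br (\<Lambda> u)"
  shows "bij_betw (br (\<Lambda> u)) \<Omega> \<Omega>"
proof (rule linear_inj_imp_bij_betw_subspace[OF linear_br subspace_killing_perp])
  show "br (\<Lambda> u) ` \<Omega> \<subseteq> \<Omega>"
    using range_br_subset_killing_perp[of "\<Lambda> u"] centralizer_\<Lambda>_eq[OF assms] by (metis image_subsetI)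
  show "v = 0" if "v \<in> \<Omega>" "br (\<Lambda> u) v = 0" for v
    using that centralizer_\<Lambda>_eq[OF assms] centralizer_perp_trivial mem_centralizer by blast
qed

lemma br_br_\<Lambda>_commute: "br u (br (\<Lambda> u) v) = br (\<Lambda> u) (br u v)"
  using jacobi[of u "\<Lambda> u" v] br_\<Lambda>_eq_0 by (simp add: br_simps)

end

section \<open>Determinants and exponentials of operators\<close>

lemma ordered_basis_exists:
  fixes V :: "'a::euclidean_space set"
  assumes "subspace V"
  shows "\<exists>bs. ordered_basis bs V"
proof -
  obtain B where B: "B \<subseteq> V" "independent B" "V \<subseteq> span B"
    using maximal_independent_subset by blast
  moreover have "span B = V"
    using B span_minimal[OF B(1) assms] by blast
  moreover obtain bs where "set bs = B" "distinct bs"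
    using finite_distinct_list[OF independent_imp_finite[OF B(2)]] by blast
  ultimately show ?thesis
    unfolding ordered_basis_def by metis
qed

text \<open>A null vector of the coordinate matrix is read as the coordinates of a vector x in V:
  the matrix product gives the coordinates of T x, and x is nonzero because its own coordinates are
  the null vector.\<close>

lemma det_on_eq_0_imp_kernel:
  fixes V :: "'a::euclidean_space set"
  assumes "subspace V" "linear T" "T ` V \<subseteq> V" "det_on V T = 0"
  shows "\<exists>x\<in>V. x \<noteq> 0 \<and> T x = 0"
proof -
  define bs where "bs = (SOME bs. ordered_basis bs V)"
  have "ordered_basis bs V"
    unfolding bs_def using ordered_basis_exists[OF assms(1)] by (rule someI_ex)
  then have bs: "distinct bs" "independent (set bs)" "span (set bs) = V"
    by (auto simp: ordered_basis_def)
  define n where "n = length bs"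
  have M: "matrix_wrt bs T \<in> carrier_mat n n"
    by (simp add: matrix_wrt_def n_def)
  obtain v where v: "v \<in> carrier_vec n" "v \<noteq> 0\<^sub>v n" "matrix_wrt bs T *\<^sub>v v = 0\<^sub>v n"
    using assms(4) det_0_iff_vec_prod_zero_field[OF M] unfolding det_on_def bs_def by blast
  have mem: "bs ! j \<in> V" if "j < n" for j
    using that bs(3) span_superset[of "set bs"] unfolding n_def by auto
  define x where "x = (\<Sum>j<n. vec_index v j *\<^sub>R bs ! j)"
  have xV: "x \<in> V"
    unfolding x_def using assms(1) mem by (intro subspace_sum subspace_scale) auto
  \<comment> \<open>\<open>representation\<close> is 0 outside the span of the basis, so its
    linearity holds only for vectors known to lie in \<open>V\<close>.\<close>
  have rep: "representation (set bs) (\<Sum>j<n. vec_index v j *\<^sub>R f j) b =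
      (\<Sum>j<n. vec_index v j * representation (set bs) (f j) b)" if "\<And>j. j < n \<Longrightarrow> f j \<in> V" for f b
  proof -
    have "representation (set bs) (\<Sum>j<n. vec_index v j *\<^sub>R f j) b =
        (\<Sum>j<n. representation (set bs) (vec_index v j *\<^sub>R f j) b)"
      by (subst real_vector.representation_sum[OF bs(2)])
        (use that bs(3) assms(1) in \<open>auto intro: subspace_scale\<close>)
    also have "\<dots> = (\<Sum>j<n. vec_index v j * representation (set bs) (f j) b)"
      by (intro sum.cong refl, subst real_vector.representation_scale[OF bs(2)])
        (use that bs(3) in auto)
    finally show ?thesis .
  qed
  have "representation (set bs) (T x) (bs ! i) = 0" if i: "i < n" for i
  proof -
    have "T x = (\<Sum>j<n. vec_index v j *\<^sub>R T (bs ! j))"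
      unfolding x_def by (simp add: linear_sum[OF assms(2)] linear_scale[OF assms(2)])
    then have "representation (set bs) (T x) (bs ! i) =
        (\<Sum>j<n. vec_index v j * representation (set bs) (T (bs ! j)) (bs ! i))"
      using rep[of "\<lambda>j. T (bs ! j)"] mem assms(3) by fastforce
    also have "\<dots> = vec_index (matrix_wrt bs T *\<^sub>v v) i"
      using i v(1) by (simp add: matrix_wrt_def mult_mat_vec_def scalar_prod_def n_def
          atLeast0LessThan mult.commute)
    finally show ?thesis
      using v(3) i by simp
  qed
  then have "representation (set bs) (T x) b = 0" if "b \<in> set bs" for b
    using that unfolding n_def by (metis in_set_conv_nth)
  then have "T x = 0"
    using real_vector.sum_representation_eq[OF bs(2), of "T x" "set bs"] xV assms(3) bs(3)
    by (simp add: image_subset_iff)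
  moreover have "x \<noteq> 0"
  proof
    assume "x = 0"
    have "vec_index v i = 0" if i: "i < n" for i
    proof -
      have "representation (set bs) x (bs ! i) =
          (\<Sum>j<n. vec_index v j * (if i = j then 1 else 0))"
        unfolding x_def
        by (subst rep[of "\<lambda>j. bs ! j"], erule mem, intro sum.cong refl)
          (use i bs(1) in \<open>simp add: real_vector.representation_basis[OF bs(2)] n_def nth_eq_iff_index_eq\<close>)
      then show ?thesis
        using i \<open>x = 0\<close> by (simp add: real_vector.representation_zero if_distrib cong: if_cong)
    qed
    then show False
      using v(1,2) by auto
  qed
  ultimately show ?thesis
    using xV by blast
qed

section \<open>Exponentials of linear operators\<close>

context
  fixes T :: "'a::euclidean_space \<Rightarrow> 'a"
  assumes lin: "linear T"
begin

lemma linear_funpow: "linear (T ^^ n)"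
proof (induction n)
  case (Suc n)
  then show ?case
    using linear_compose[of "T ^^ n" T] lin by (simp add: comp_def)
qed (simp add: linear_id[unfolded id_def])

lemma summable_op_exp: "summable (\<lambda>n. (T ^^ n) v /\<^sub>R fact n)"
proof -
  obtain K where K: "K > 0" "\<And>x. norm (T x) \<le> K * norm x"
    using linear_bounded_pos[OF lin] by blast
  have pow: "norm ((T ^^ n) v) \<le> K ^ n * norm v" for n
  proof (induction n)
    case (Suc n)
    have "norm ((T ^^ Suc n) v) \<le> K * norm ((T ^^ n) v)"
      using K(2) by simp
    also have "\<dots> \<le> K * (K ^ n * norm v)"
      using Suc K(1) by (intro mult_left_mono) auto
    finally show ?case by simp
  qed simp
  have "summable (\<lambda>n. (K ^ n /\<^sub>R fact n) * norm v)"
    by (intro summable_mult2 summable_exp_generic)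
  then show ?thesis
    by (rule summable_comparison_test') (use pow in \<open>simp add: field_simps\<close>)
qed

text \<open>Exhibits the exponential of tT as a power series in t with fixed vector coefficients,
  the form in which it can be differentiated termwise.\<close>

lemma op_exp_scaleR:
  "op_exp (\<lambda>w. t *\<^sub>R T w) v = (\<Sum>n. t ^ n *\<^sub>R ((T ^^ n) v /\<^sub>R fact n))"
proof -
  have "((\<lambda>w. t *\<^sub>R T w) ^^ n) v = t ^ n *\<^sub>R (T ^^ n) v" for n
    by (induction n) (simp_all add: linear_scale[OF lin])
  then show ?thesis
    by (simp add: op_exp_def mult.commute)
qed

lemma linear_op_exp: "linear (op_exp T)"
proof
  fix v w :: 'a and c :: real
  show "op_exp T (v + w) = op_exp T v + op_exp T w"
    unfolding op_exp_def
    by (subst suminf_add[OF summable_op_exp summable_op_exp])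
      (simp add: linear_add[OF linear_funpow] scaleR_add_right)
  show "op_exp T (c *\<^sub>R v) = c *\<^sub>R op_exp T v"
    unfolding op_exp_def
    by (subst suminf_scaleR_right[OF summable_op_exp])
      (simp add: linear_scale[OF linear_funpow] mult.commute)
qed

text \<open>The partial sums stay in \<open>V\<close>, and a subspace of a finite-dimensional space
  is closed.\<close>

lemma op_exp_mem_subspace:
  assumes "subspace V" "T ` V \<subseteq> V" "v \<in> V"
  shows "op_exp T v \<in> V"
proof -
  have pow: "(T ^^ n) v \<in> V" for n
    by (induction n) (use assms in auto)
  have "(\<lambda>N. \<Sum>n<N. (T ^^ n) v /\<^sub>R fact n) \<longlonglongrightarrow> op_exp T v"
    unfolding op_exp_def by (rule summable_LIMSEQ[OF summable_op_exp])
  then show ?thesis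
    by (rule closed_sequentially[OF closed_subspace[OF assms(1)], rotated])
      (intro subspace_sum subspace_scale pow assms(1))
qed

end

lemma op_exp_0_scaleR:
  fixes T :: "'a::euclidean_space \<Rightarrow> 'a"
  assumes "linear T"
  shows "op_exp (\<lambda>w. 0 *\<^sub>R T w) v = v"
  unfolding op_exp_scaleR[OF assms]
  using suminf_finite[of "{0}" "\<lambda>n. 0 ^ n *\<^sub>R ((T ^^ n) v /\<^sub>R fact n)"]
  by simp

text \<open>Each coordinate is a real power series converging everywhere. Termwise differentiation
  shifts the coefficients by one, which replaces v by T v; then T commutes with its
  exponential.\<close>

lemma op_exp_has_vector_derivative:
  fixes T :: "'a::euclidean_space \<Rightarrow> 'a"
  assumes "linear T"
  shows "((\<lambda>t. op_exp (\<lambda>w. t *\<^sub>R T w) v) has_vector_derivative T (op_exp (\<lambda>w. t *\<^sub>R T w) v)) (at t)"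
proof -
  have summable: "summable (\<lambda>n. t ^ n *\<^sub>R ((T ^^ n) v /\<^sub>R fact n))" for t v
  proof -
    have "linear (\<lambda>w. t *\<^sub>R T w)"
      using assms by (simp add: linear_compose_scale_right)
    from summable_op_exp[OF this, of v] show ?thesis
    proof (rule summable_cong[THEN iffD1, rotated], intro always_eventually allI)
      fix n
      have "((\<lambda>w. t *\<^sub>R T w) ^^ n) v = t ^ n *\<^sub>R (T ^^ n) v" for n
        by (induction n) (simp_all add: linear_scale[OF assms])
      then show "((\<lambda>w. t *\<^sub>R T w) ^^ n) v /\<^sub>R fact n = t ^ n *\<^sub>R ((T ^^ n) v /\<^sub>R fact n)"
        by simp
    qed
  qed
  have inner_eq: "inner (op_exp (\<lambda>w. t *\<^sub>R T w) v) b = (\<Sum>n. inner ((T ^^ n) v) b / fact n * t ^ n)"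
    and summable_inner: "summable (\<lambda>n. inner ((T ^^ n) v) b / fact n * t ^ n)" for t v b
    using bounded_linear.suminf[OF bounded_linear_inner_left summable[of t v], of b]
      bounded_linear.summable[OF bounded_linear_inner_left summable[of t v], of b]
    by (simp_all add: op_exp_scaleR[OF assms] field_simps)
  have T_op_exp: "T (op_exp (\<lambda>w. t *\<^sub>R T w) v) = op_exp (\<lambda>w. t *\<^sub>R T w) (T v)"
    unfolding op_exp_scaleR[OF assms]
    using bounded_linear.suminf[OF linear_conv_bounded_linear[THEN iffD1, OF assms] summable[of t v]]
    by (simp add: linear_scale[OF assms] funpow_swap1)
  have "((\<lambda>t. inner (op_exp (\<lambda>w. t *\<^sub>R T w) v) b) has_real_derivative
      inner (op_exp (\<lambda>w. t *\<^sub>R T w) (T v)) b) (at t)" for b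
  proof -
    have "diffs (\<lambda>n. inner ((T ^^ n) v) b / fact n) = (\<lambda>n. inner ((T ^^ n) (T v)) b / fact n)"
      by (auto simp: diffs_def funpow_swap1 fact_Suc simp del: of_nat_Suc)
    then show ?thesis
      using termdiffs_strong_converges_everywhere[OF summable_inner[of v b], of t]
      by (simp add: inner_eq)
  qed
  then show ?thesis
    unfolding T_op_exp has_vector_derivative_def
    by (subst has_derivative_componentwise_within)
      (auto simp: has_field_derivative_def mult_commute_abs)
qed

text \<open>Differentiating M(E t) gives M(L(E t)), again a linear image of E. With M universally
  quantified, the induction on the order closes.\<close>

lemma smooth_on_linear_ode:
  fixes E :: "real \<Rightarrow> 'a::euclidean_space" and M :: "'a \<Rightarrow> 'b::real_normed_vector"
  assumes E: "\<And>t. (E has_vector_derivative L (E t)) (at t)" and "linear L" "linear M"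
  shows "smooth_on UNIV (\<lambda>t. M (E t))"
proof -
  have "Ck_on k UNIV (\<lambda>t. M (E t))" if "linear M" for k and M :: "'a \<Rightarrow> 'b"
    using that
  proof (induction k arbitrary: M)
    case 0
    have "continuous_on UNIV E"
      using E by (intro continuous_at_imp_continuous_on ballI has_vector_derivative_continuous) auto
    then show ?case
      using linear_continuous_on_compose 0 by auto
  next
    case (Suc k)
    have lin: "linear (\<lambda>x. v *\<^sub>R M (L x))" for v
      using linear_compose[OF assms(2) Suc.prems]
      by (simp add: linear_compose_scale_right comp_def)
    have "((\<lambda>t. M (E t)) has_derivative (\<lambda>v. v *\<^sub>R M (L (E t)))) (at t)" for t
      using bounded_linear.has_vector_derivative[OF linear_conv_bounded_linear[THEN iffD1, OF Suc.prems] E[of t]]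
      by (simp add: has_vector_derivative_def)
    then show ?case
      by (rule Ck_on_SucI[OF open_UNIV]) (rule Suc.IH[OF lin])
  qed
  then show ?thesis
    using assms(3) by (simp add: smooth_on_def)
qed

section \<open>Vector fields and connections on a Lie group\<close>

context lie_group
begin

lemma atlas_space_eq: "atlas_space \<A> = carrier G"
  using smooth_manifold topspace_eq by (simp add: smooth_manifold_def)

lemma
  assumes "(U, \<phi>) \<in> \<A>"
  shows chart_subset: "U \<subseteq> carrier G"
    and chart_openin: "openin T U"
    and chart_open: "open (\<phi> ` U)"
    and chart_homeomorphic: "homeomorphic_map (subtopology T U) (top_of_set (\<phi> ` U)) \<phi>"
    and chart_inj: "inj_on \<phi> U"
proof -
  show *: "openin T U" "open (\<phi> ` U)"
    "homeomorphic_map (subtopology T U) (top_of_set (\<phi> ` U)) \<phi>"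
    using smooth_manifold assms by (auto simp: smooth_manifold_def)
  then show U: "U \<subseteq> carrier G"
    using openin_subset topspace_eq by blast
  show "inj_on \<phi> U"
    using homeomorphic_imp_injective_map[OF *(3)] U topspace_eq
    by (simp add: topspace_subtopology Int_absorb1)
qed

lemma inv_chart_mem:
  assumes "x \<in> \<phi> ` U"
  shows "inv_into U \<phi> x \<in> U" "\<phi> (inv_into U \<phi> x) = x"
  using assms by (auto simp: inv_into_into f_inv_into_f)

lemma chart_cover:
  assumes "p \<in> carrier G"
  obtains U \<phi> where "(U, \<phi>) \<in> \<A>" "p \<in> U"
  using assms unfolding atlas_space_eq[symmetric] atlas_space_def by auto

lemma smooth_funI:
  assumes "\<And>U \<phi>. (U, \<phi>) \<in> \<A> \<Longrightarrow> smooth_on (\<phi> ` U) (\<lambda>x. f (inv_into U \<phi> x))"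
  shows "smooth_fun \<A> f"
  using assms by (auto simp: smooth_fun_def)

lemma smooth_funD:
  "smooth_fun \<A> f \<Longrightarrow> (U, \<phi>) \<in> \<A> \<Longrightarrow> smooth_on (\<phi> ` U) (\<lambda>x. f (inv_into U \<phi> x))"
  by (auto simp: smooth_fun_def)

lemma smooth_fun_cong:
  assumes "\<And>p. p \<in> carrier G \<Longrightarrow> f p = g p" "smooth_fun \<A> f"
  shows "smooth_fun \<A> g"
proof (rule smooth_funI)
  fix U \<phi> assume U: "(U, \<phi>) \<in> \<A>"
  have "f (inv_into U \<phi> x) = g (inv_into U \<phi> x)" if "x \<in> \<phi> ` U" for x
    using chart_subset[OF U] inv_chart_mem(1)[OF that] assms(1) by blast
  then show "smooth_on (\<phi> ` U) (\<lambda>x. g (inv_into U \<phi> x))"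
    by (rule smooth_on_cong[OF chart_open[OF U] _ smooth_funD[OF assms(2) U]])
qed

lemma smooth_fun_const: "smooth_fun \<A> (\<lambda>p. c)"
  by (intro smooth_funI smooth_on_const chart_open)

lemma smooth_fun_add:
  assumes "smooth_fun \<A> f" "smooth_fun \<A> g"
  shows "smooth_fun \<A> (\<lambda>p. f p + g p)"
  by (intro smooth_funI smooth_on_add[OF chart_open smooth_funD[OF assms(1)] smooth_funD[OF assms(2)]])

lemma smooth_fun_sum:
  assumes "finite I" "\<And>i. i \<in> I \<Longrightarrow> smooth_fun \<A> (f i)"
  shows "smooth_fun \<A> (\<lambda>p. \<Sum>i\<in>I. f i p)"
  using assms by (induction I rule: finite_induct) (simp_all add: smooth_fun_const smooth_fun_add)

lemma smooth_fun_linear: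
  assumes "bounded_linear L" "smooth_fun \<A> f"
  shows "smooth_fun \<A> (\<lambda>p. L (f p))"
  by (intro smooth_funI smooth_on_linear[OF assms(1) chart_open smooth_funD[OF assms(2)]])

lemma smooth_fun_bilinear:
  assumes "bounded_bilinear P" "smooth_fun \<A> f" "smooth_fun \<A> g"
  shows "smooth_fun \<A> (\<lambda>p. P (f p) (g p))"
  by (intro smooth_funI
      smooth_on_bilinear[OF assms(1) chart_open smooth_funD[OF assms(2)] smooth_funD[OF assms(3)]])

lemmas smooth_fun_mult = smooth_fun_bilinear[OF bounded_bilinear_mult]
lemmas smooth_fun_scaleR = smooth_fun_bilinear[OF bounded_bilinear_scaleR]
lemmas smooth_fun_inner_left = smooth_fun_linear[OF bounded_linear_inner_left]

text \<open>The group axioms give smoothness of the product only in charts. Near each point, charts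
  around g, p and g p are fixed, the first argument is frozen at g, and f is read in the last
  chart.\<close>

lemma smooth_fun_left_translate:
  assumes f: "smooth_fun \<A> f" and g: "g \<in> carrier G"
  shows "smooth_fun \<A> (\<lambda>q. f (g \<otimes> q))"
proof (rule smooth_funI, rule smooth_on_local)
  fix U \<phi> x0 assume U: "(U, \<phi>) \<in> \<A>" and x0: "x0 \<in> \<phi> ` U"
  let ?p = "inv_into U \<phi>"
  have p0: "g \<otimes> ?p x0 \<in> carrier G"
    using g chart_subset[OF U] inv_chart_mem(1)[OF x0] by blast
  obtain V \<psi> where V: "(V, \<psi>) \<in> \<A>" "g \<in> V" by (rule chart_cover[OF g])
  obtain W \<theta> where W: "(W, \<theta>) \<in> \<A>" "g \<otimes> ?p x0 \<in> W" by (rule chart_cover[OF p0])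
  define N where "N = {x \<in> \<phi> ` U. g \<otimes> ?p x \<in> W}"
  \<comment> \<open>Continuity of left translation makes \<open>N\<close> open: on it the translated
    point stays within the target chart.\<close>
  have "continuous_map T T (\<lambda>q. g \<otimes> q)"
    using continuous_map_compose[OF continuous_map_pairedI[of T T "\<lambda>_. g" T "\<lambda>q. q"] continuous_mult]
      g topspace_eq by (simp add: comp_def)
  then have "openin T {q \<in> topspace T. g \<otimes> q \<in> W}"
    by (rule openin_continuous_map_preimage[OF _ chart_openin[OF W(1)]])
  then have "openin (subtopology T U) (U \<inter> {q \<in> topspace T. g \<otimes> q \<in> W})"
    by (rule openin_subtopology_Int2)
  then have "openin (top_of_set (\<phi> ` U)) (\<phi> ` (U \<inter> {q \<in> topspace T. g \<otimes> q \<in> W}))"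
    using homeomorphic_imp_open_map[OF chart_homeomorphic[OF U]] by (simp add: open_map_def)
  moreover have "\<phi> ` (U \<inter> {q \<in> topspace T. g \<otimes> q \<in> W}) = N"
    unfolding N_def using chart_inj[OF U] chart_subset[OF U] topspace_eq
    by (auto simp: inv_into_f_f image_iff)
  ultimately have "open N"
    using chart_open[OF U] openin_open_trans by auto
  let ?m = "\<lambda>(y, x). \<theta> (inv_into V \<psi> y \<otimes> ?p x)"
  have m: "smooth_on {(y, x). y \<in> \<psi> ` V \<and> x \<in> \<phi> ` U \<and> inv_into V \<psi> y \<otimes> ?p x \<in> W} ?m"
    by (rule smooth_mult[OF V(1) U W(1)])
  have \<psi>g: "inv_into V \<psi> (\<psi> g) = g"
    using chart_inj[OF V(1)] V(2) by simp
  have "smooth_on N (\<lambda>x. ?m (\<psi> g, x))"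
    by (rule smooth_on_compose[OF \<open>open N\<close> smooth_on_Pair[OF \<open>open N\<close>] m])
      (use V(2) in \<open>auto simp: N_def \<psi>g\<close>)
  then have "smooth_on N (\<lambda>x. \<theta> (g \<otimes> ?p x))"
    by (simp add: \<psi>g)
  then have "smooth_on N (\<lambda>x. f (inv_into W \<theta> (\<theta> (g \<otimes> ?p x))))"
    by (rule smooth_on_compose[OF \<open>open N\<close> _ smooth_funD[OF f W(1)]]) (auto simp: N_def)
  then have "smooth_on N (\<lambda>x. f (g \<otimes> ?p x))"
    by (rule smooth_on_cong[OF \<open>open N\<close>, rotated])
      (simp add: N_def inv_into_f_f[OF chart_inj[OF W(1)]])
  then show "\<exists>N. open N \<and> x0 \<in> N \<and> smooth_on N (\<lambda>x. f (g \<otimes> ?p x))"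
    using \<open>open N\<close> x0 W(2) by (auto simp: N_def)
qed

end

section \<open>Left-invariant fields as derivations and the bracket they induce\<close>

context lie_group_with_algebra
begin

lemma X_derivation: "derivation \<A> (X u)"
  using X_left_invariant by (simp add: left_invariant_derivation_def)

lemma X_smooth: "smooth_fun \<A> f \<Longrightarrow> smooth_fun \<A> (X u f)"
  using X_derivation by (simp add: derivation_def)

lemma
  assumes "smooth_fun \<A> f" "smooth_fun \<A> h" "p \<in> carrier G"
  shows X_fun_add: "X u (\<lambda>q. f q + h q) p = X u f p + X u h p"
    and X_fun_mult: "X u (\<lambda>q. f q * h q) p = X u f p * h p + f p * X u h p"
  using assms X_derivation[of u] by (auto simp: derivation_def atlas_space_eq)

lemma X_fun_scale:
  assumes "smooth_fun \<A> f" "p \<in> carrier G"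
  shows "X u (\<lambda>q. c * f q) p = c * X u f p"
  using assms X_derivation[of u] by (auto simp: derivation_def atlas_space_eq)

text \<open>The Leibniz rule for 1 = 1 * 1 gives X 1 = 2 X 1; scaling handles the other
  constants.\<close>

lemma X_const:
  assumes p: "p \<in> carrier G"
  shows "X u (\<lambda>_. c) p = 0"
proof -
  have "X u (\<lambda>_. 1) p = 0"
    using X_fun_mult[OF smooth_fun_const smooth_fun_const p, of u 1 1] by simp
  then show ?thesis
    using X_fun_scale[OF smooth_fun_const p, of u c 1] by simp
qed

lemma X_fun_sum:
  assumes "finite I" "\<And>i. i \<in> I \<Longrightarrow> smooth_fun \<A> (f i)" "p \<in> carrier G"
  shows "X u (\<lambda>q. \<Sum>i\<in>I. f i q) p = (\<Sum>i\<in>I. X u (f i) p)"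
  using assms
  by (induction I rule: finite_induct) (simp_all add: X_const X_fun_add smooth_fun_sum)

text \<open>A derivation only sees the values on the group: if \<open>f = g\<close> there, then \<open>h = g - f\<close> satisfies
  \<open>h = h c\<close>, where the smooth function \<open>c\<close> is the indicator of the complement.\<close>

lemma X_cong:
  assumes "\<And>q. q \<in> carrier G \<Longrightarrow> f q = g q" "smooth_fun \<A> f" "p \<in> carrier G"
  shows "X u f p = X u g p"
proof -
  define c :: "'g \<Rightarrow> real" where "c q = (if q \<in> carrier G then 0 else 1)" for q
  define h where "h q = g q - f q" for q
  have h0: "h q = 0" if "q \<in> carrier G" for q
    using that assms(1) by (simp add: h_def)
  have c: "smooth_fun \<A> c"
    by (rule smooth_fun_cong[OF _ smooth_fun_const[of 0]]) (simp add: c_def)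
  have h: "smooth_fun \<A> h"
    by (rule smooth_fun_cong[OF _ smooth_fun_const[of 0]]) (simp add: h0)
  have "X u h p = X u (\<lambda>q. h q * c q) p"
    by (rule arg_cong[where f = "\<lambda>h. X u h p"]) (auto simp: c_def h0)
  also have "\<dots> = 0"
    using X_fun_mult[OF h c assms(3), of u] h0[OF assms(3)] assms(3) by (simp add: c_def[of p])
  finally show ?thesis
    using X_fun_add[OF assms(2) h assms(3), of u] by (simp add: h_def)
qed

lemma X_eqI:
  assumes "\<And>f p. smooth_fun \<A> f \<Longrightarrow> p \<in> carrier G \<Longrightarrow> X u f p = X v f p"
  shows "u = v"
proof -
  have "X (u + (- 1) *\<^sub>R v) f p = 0" if "smooth_fun \<A> f" "p \<in> carrier G" for f p
    using assms[OF that] X_linear[OF that, of _ v "- 1"] X_linear[OF that, of u "(- 1) *\<^sub>R v"] by simp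
  then show ?thesis
    using X_injective[of "u + (- 1) *\<^sub>R v"] by simp
qed

lemma linear_X:
  assumes "smooth_fun \<A> f" "p \<in> carrier G"
  shows "linear (\<lambda>u. X u f p)"
  using X_linear[OF assms] by (auto simp: linear_iff)

lemma X_expand:
  assumes "smooth_fun \<A> f" "p \<in> carrier G"
  shows "X u f p = (\<Sum>b\<in>Basis. inner u b * X b f p)"
  using linear_sum[OF linear_X[OF assms], of "\<lambda>b. inner u b *\<^sub>R b" Basis]
  by (simp add: linear_scale[OF linear_X[OF assms]] euclidean_representation)

text \<open>The inner function is linear in v only at points of the group, so \<open>X_cong\<close>
  must replace it before the outer derivation laws apply.\<close>

lemma linear_X_X:
  assumes "smooth_fun \<A> f" "p \<in> carrier G"
  shows "linear (\<lambda>v. X u (X v f) p)"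
proof (rule linearI)
  fix v w and c :: real
  have "X u (X (v + w) f) p = X u (\<lambda>q. X v f q + X w f q) p"
    using X_linear[OF assms(1)] by (intro X_cong assms X_smooth) auto
  then show "X u (X (v + w) f) p = X u (X v f) p + X u (X w f) p"
    using assms by (simp add: X_fun_add X_smooth)
  have "X u (X (c *\<^sub>R v) f) p = X u (\<lambda>q. c * X v f q) p"
    using X_linear[OF assms(1)] by (intro X_cong assms X_smooth) auto
  then show "X u (X (c *\<^sub>R v) f) p = c *\<^sub>R X u (X v f) p"
    using assms by (simp add: X_fun_scale X_smooth)
qed

lemma X_bracket':
  assumes "smooth_fun \<A> f" "p \<in> carrier G"
  shows "X u (X (br v w) f) p = X u (X v (X w f)) p - X u (X w (X v f)) p"
proof -
  have "X u (X (br v w) f) p + X u (X w (X v f)) p = X u (\<lambda>q. X (br v w) f q + X w (X v f) q) p"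
    using assms by (simp add: X_fun_add X_smooth)
  also have "\<dots> = X u (X v (X w f)) p"
    using assms by (intro X_cong smooth_fun_add X_smooth) (simp_all add: X_bracket)
  finally show ?thesis by simp
qed

text \<open>The identities hold for commutators of derivations acting on smooth functions, and
  injectivity of \<open>X\<close> carries them back to \<open>br\<close>.\<close>

lemma real_lie_algebra: "real_lie_algebra br"
proof
  have X_add: "X (u + v) f p = X u f p + X v f p" and X_scale: "X (c *\<^sub>R u) f p = c * X u f p"
    if "smooth_fun \<A> f" "p \<in> carrier G" for u v c f p
    using X_linear[OF that] by auto
  have XX_add: "X w (X (u + v) f) p = X w (X u f) p + X w (X v f) p"
    and XX_scale: "X w (X (c *\<^sub>R u) f) p = c * X w (X u f) p"
    if "smooth_fun \<A> f" "p \<in> carrier G" for u v w c f p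
    using linear_add[OF linear_X_X[OF that]] linear_scale[OF linear_X_X[OF that]] by auto
  note simps = X_bracket X_add X_scale XX_add XX_scale X_smooth X_bracket' algebra_simps
  show "bilinear br"
    unfolding bilinear_def linear_iff by (intro conjI allI; rule X_eqI; simp add: simps)
  show "br u u = 0" for u
    by (rule X_injective) (simp add: X_bracket)
  show "br u (br v w) = br (br u v) w + br v (br u w)" for u v w
    by (rule X_eqI) (simp add: simps)
qed

text \<open>\<open>X u\<close> acts on real functions, so vector fields are differentiated by
  coordinates. This is the flat connection of the left trivialisation, for which left-invariant
  fields are parallel.\<close>

definition vdiff :: "'a \<Rightarrow> ('g \<Rightarrow> 'a) \<Rightarrow> 'g \<Rightarrow> 'a" where
  "vdiff u W p = (\<Sum>b\<in>Basis. X u (\<lambda>q. inner (W q) b) p *\<^sub>R b)"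

lemma inner_vdiff: "b \<in> Basis \<Longrightarrow> inner (vdiff u W p) b = X u (\<lambda>q. inner (W q) b) p"
  by (simp add: vdiff_def)

lemma vdiff_cong:
  assumes "\<And>q. q \<in> carrier G \<Longrightarrow> V q = W q" "smooth_fun \<A> V" "p \<in> carrier G"
  shows "vdiff u V p = vdiff u W p"
  unfolding vdiff_def using assms
  by (intro sum.cong refl arg_cong2[where f = scaleR] X_cong smooth_fun_inner_left) auto

lemma vdiff_const: "p \<in> carrier G \<Longrightarrow> vdiff u (\<lambda>_. c) p = 0"
  by (simp add: vdiff_def X_const)

lemma linear_vdiff:
  assumes "smooth_fun \<A> W" "p \<in> carrier G"
  shows "linear (\<lambda>u. vdiff u W p)"
  unfolding vdiff_def
  by (intro linear_compose_sum ballI linear_scaleR_left[THEN linear_compose[rotated, unfolded comp_def]]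
      linear_X smooth_fun_inner_left assms)

lemma vdiff_add:
  assumes "smooth_fun \<A> V" "smooth_fun \<A> W" "p \<in> carrier G"
  shows "vdiff u (\<lambda>q. V q + W q) p = vdiff u V p + vdiff u W p"
  using assms
  by (simp add: vdiff_def inner_add_left X_fun_add smooth_fun_inner_left scaleR_add_left sum.distrib)

lemma vdiff_scaleR:
  assumes "smooth_fun \<A> h" "smooth_fun \<A> W" "p \<in> carrier G"
  shows "vdiff u (\<lambda>q. h q *\<^sub>R W q) p = h p *\<^sub>R vdiff u W p + X u h p *\<^sub>R W p"
proof (rule euclidean_eqI)
  fix b :: 'a assume b: "b \<in> Basis"
  show "inner (vdiff u (\<lambda>q. h q *\<^sub>R W q) p) b = inner (h p *\<^sub>R vdiff u W p + X u h p *\<^sub>R W p) b"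
    using X_fun_mult[OF assms(1) smooth_fun_inner_left[OF assms(2)] assms(3), of u b]
    by (simp add: inner_vdiff[OF b] inner_add_left)
qed

lemma X_linear_comp:
  assumes l: "linear l" and W: "smooth_fun \<A> W" and p: "p \<in> carrier G"
  shows "X u (\<lambda>q. l (W q)) p = l (vdiff u W p)"
proof -
  have expand: "l w = (\<Sum>b\<in>Basis. l b * inner w b)" for w
    using linear_sum[OF l, of "\<lambda>b. inner w b *\<^sub>R b" Basis]
    by (simp add: linear_scale[OF l] euclidean_representation mult.commute)
  have "X u (\<lambda>q. l (W q)) p = X u (\<lambda>q. \<Sum>b\<in>Basis. l b * inner (W q) b) p"
    by (rule arg_cong[where f = "\<lambda>h. X u h p"], rule ext, rule expand)
  also have "\<dots> = (\<Sum>b\<in>Basis. l b * X u (\<lambda>q. inner (W q) b) p)"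
    by (subst X_fun_sum[OF finite_Basis _ p])
      (simp_all add: X_fun_scale p W smooth_fun_inner_left smooth_fun_mult smooth_fun_const)
  also have "\<dots> = l (vdiff u W p)"
    unfolding expand[of "vdiff u W p"] by (simp add: inner_vdiff)
  finally show ?thesis .
qed

lemma smooth_fun_bilinear':
  fixes m :: "'a \<Rightarrow> 'a \<Rightarrow> 'c::real_normed_vector"
  shows "bilinear m \<Longrightarrow> smooth_fun \<A> V \<Longrightarrow> smooth_fun \<A> W \<Longrightarrow> smooth_fun \<A> (\<lambda>p. m (V p) (W p))"
  by (rule smooth_fun_bilinear) (simp_all add: bilinear_conv_bounded_bilinear)

lemma X_bilinear_comp:
  fixes m :: "'a \<Rightarrow> 'a \<Rightarrow> real"
  assumes m: "bilinear m" and V: "smooth_fun \<A> V" and W: "smooth_fun \<A> W" and p: "p \<in> carrier G"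
  shows "X u (\<lambda>q. m (V q) (W q)) p = m (vdiff u V p) (W p) + m (V p) (vdiff u W p)"
proof -
  have lin: "linear (m v)" "linear (\<lambda>v. m v w)" for v w
    using m by (auto simp: bilinear_def)
  have expand: "m v w = (\<Sum>b\<in>Basis. inner v b * m b w)" for v w
    using linear_sum[OF lin(2), of "\<lambda>b. inner v b *\<^sub>R b" Basis w]
    by (simp add: linear_scale[OF lin(2)] euclidean_representation)
  have mb: "smooth_fun \<A> (\<lambda>q. m b (W q))" for b
    using smooth_fun_bilinear'[OF m smooth_fun_const W] .
  have "X u (\<lambda>q. m (V q) (W q)) p = X u (\<lambda>q. \<Sum>b\<in>Basis. inner (V q) b * m b (W q)) p"
    by (rule arg_cong[where f = "\<lambda>h. X u h p"], rule ext, rule expand)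
  also have "\<dots> = (\<Sum>b\<in>Basis. X u (\<lambda>q. inner (V q) b * m b (W q)) p)"
    by (intro X_fun_sum finite_Basis p smooth_fun_mult mb smooth_fun_inner_left V)
  also have "\<dots> = (\<Sum>b\<in>Basis. inner (vdiff u V p) b * m b (W p))
      + (\<Sum>b\<in>Basis. inner (V p) b * m b (vdiff u W p))"
    by (simp add: X_fun_mult[OF smooth_fun_inner_left[OF V] mb p] X_linear_comp[OF lin(1) W p]
        inner_vdiff sum.distrib)
  finally show ?thesis
    unfolding expand[symmetric] .
qed

lemma smooth_fun_X_field:
  assumes "smooth_fun \<A> V" "smooth_fun \<A> f"
  shows "smooth_fun \<A> (\<lambda>p. X (V p) f p)"
proof (rule smooth_fun_cong)
  show "smooth_fun \<A> (\<lambda>p. \<Sum>b\<in>Basis. inner (V p) b * X b f p)"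
    using assms by (intro smooth_fun_sum smooth_fun_mult finite_Basis smooth_fun_inner_left X_smooth)
qed (use X_expand assms(2) in simp)

lemma smooth_fun_vdiff:
  assumes "smooth_fun \<A> V" "smooth_fun \<A> W"
  shows "smooth_fun \<A> (\<lambda>p. vdiff (V p) W p)"
  unfolding vdiff_def using assms
  by (intro smooth_fun_sum smooth_fun_scaleR finite_Basis smooth_fun_X_field
      smooth_fun_inner_left smooth_fun_const)

text \<open>Expanding W in the basis and applying the product rule separates a first-order term,
  with the coefficients of W differentiated, from a second-order term with W frozen at p.
  Antisymmetrised, this computes the commutator of two fields.\<close>

lemma X_X_field:
  assumes W: "smooth_fun \<A> W" and h: "smooth_fun \<A> h" and p: "p \<in> carrier G"
  shows "X v (\<lambda>q. X (W q) h q) p = X (vdiff v W p) h p + X v (X (W p) h) p"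
proof -
  have "X v (\<lambda>q. X (W q) h q) p = X v (\<lambda>q. \<Sum>b\<in>Basis. inner (W q) b * X b h q) p"
    using X_expand[OF h] by (intro X_cong smooth_fun_X_field W h p)
  also have "\<dots> = (\<Sum>b\<in>Basis. X v (\<lambda>q. inner (W q) b * X b h q) p)"
    by (intro X_fun_sum finite_Basis p smooth_fun_mult smooth_fun_inner_left W X_smooth h)
  also have "\<dots> = (\<Sum>b\<in>Basis. inner (vdiff v W p) b * X b h p)
      + (\<Sum>b\<in>Basis. inner (W p) b * X v (X b h) p)"
    by (simp add: X_fun_mult[OF smooth_fun_inner_left[OF W] X_smooth[OF h] p] inner_vdiff sum.distrib)
  also have "(\<Sum>b\<in>Basis. inner (vdiff v W p) b * X b h p) = X (vdiff v W p) h p"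
    by (rule X_expand[OF h p, symmetric])
  also have "(\<Sum>b\<in>Basis. inner (W p) b * X v (X b h) p) = X v (X (W p) h) p"
    using linear_sum[OF linear_X_X[OF h p], of v "\<lambda>b. inner (W p) b *\<^sub>R b" Basis]
    by (simp add: linear_scale[OF linear_X_X[OF h p]] euclidean_representation)
  finally show ?thesis .
qed

section \<open>Left-invariant connections and their curvature\<close>

definition inv_connection :: "('a \<Rightarrow> 'a \<Rightarrow> 'a) \<Rightarrow> ('g \<Rightarrow> 'a) \<Rightarrow> ('g \<Rightarrow> 'a) \<Rightarrow> 'g \<Rightarrow> 'a" where
  "inv_connection \<Gamma> V W p = vdiff (V p) W p + \<Gamma> (V p) (W p)"

text \<open>The flat part \<open>vdiff\<close> preserves a constant form but has torsion -br on
  left-invariant fields. Adding \<Gamma> cancels the torsion, and skewness of \<Gamma> for m keeps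
  the connection metric.\<close>

lemma levi_civita_inv_connection:
  assumes \<Gamma>: "bilinear \<Gamma>" and torsion: "\<And>u v. \<Gamma> u v - \<Gamma> v u = br u v"
    and m: "bilinear m" and metric: "\<And>u v w. m (\<Gamma> u v) w + m v (\<Gamma> u w) = 0"
  shows "levi_civita \<A> X (\<lambda>_. m) (inv_connection \<Gamma>)"
  unfolding levi_civita_def
proof (intro conjI allI impI)
  fix V W :: "'g \<Rightarrow> 'a" assume VW: "smooth_fun \<A> V" "smooth_fun \<A> W"
  show "smooth_fun \<A> (inv_connection \<Gamma> V W)"
    unfolding inv_connection_def[abs_def]
    by (rule smooth_fun_add[OF smooth_fun_vdiff[OF VW] smooth_fun_bilinear'[OF \<Gamma> VW]])
next
  fix V W Z :: "'g \<Rightarrow> 'a" and h :: "'g \<Rightarrow> real" and p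
  assume V: "smooth_fun \<A> V" and W: "smooth_fun \<A> W" and Z: "smooth_fun \<A> Z"
    and h: "smooth_fun \<A> h" and "p \<in> atlas_space \<A>"
  then have p: "p \<in> carrier G" by (simp add: atlas_space_eq)
  let ?nab = "inv_connection \<Gamma>"
  note \<Gamma>_simps = bilinear_ladd[OF \<Gamma>] bilinear_radd[OF \<Gamma>] bilinear_lmul[OF \<Gamma>] bilinear_rmul[OF \<Gamma>]
  note vdiff_simps = linear_add[OF linear_vdiff[OF Z p]] linear_scale[OF linear_vdiff[OF Z p]]
  show "?nab (\<lambda>q. V q + W q) Z p = ?nab V Z p + ?nab W Z p"
    "?nab (\<lambda>q. h q *\<^sub>R V q) Z p = h p *\<^sub>R ?nab V Z p"
    by (simp_all add: inv_connection_def \<Gamma>_simps vdiff_simps scaleR_add_right)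
  show "?nab V (\<lambda>q. W q + Z q) p = ?nab V W p + ?nab V Z p"
    by (simp add: inv_connection_def \<Gamma>_simps vdiff_add W Z p)
  show "?nab V (\<lambda>q. h q *\<^sub>R W q) p = h p *\<^sub>R ?nab V W p + X (V p) h p *\<^sub>R W p"
    by (simp add: inv_connection_def \<Gamma>_simps vdiff_scaleR h W p scaleR_add_right)
  have "?nab V W p - ?nab W V p = vdiff (V p) W p - vdiff (W p) V p + br (V p) (W p)"
    unfolding inv_connection_def torsion[symmetric] by simp
  then show "X (?nab V W p - ?nab W V p) h p =
      X (V p) (\<lambda>q. X (W q) h q) p - X (W p) (\<lambda>q. X (V q) h q) p"
    by (simp add: X_X_field[OF W h p] X_X_field[OF V h p] linear_add[OF linear_X[OF h p]]
        linear_diff[OF linear_X[OF h p]] X_bracket[OF h p])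
  show "X (V p) (\<lambda>q. m (W q) (Z q)) p = m (?nab V W p) (Z p) + m (W p) (?nab V Z p)"
    using metric[of "V p" "W p" "Z p"]
    by (simp add: X_bilinear_comp[OF m W Z p] inv_connection_def bilinear_ladd[OF m]
        bilinear_radd[OF m])
qed

lemma curvature_inv_connection:
  assumes p: "p \<in> carrier G" and "bilinear \<Gamma>"
  shows "curvature br (inv_connection \<Gamma>) p u v w =
    \<Gamma> u (\<Gamma> v w) - \<Gamma> v (\<Gamma> u w) - \<Gamma> (br u v) w"
proof -
  have const: "inv_connection \<Gamma> (\<lambda>_. v) (\<lambda>_. w) q = \<Gamma> v w" if "q \<in> carrier G" for v w q
    using that by (simp add: inv_connection_def vdiff_const)
  have smooth: "smooth_fun \<A> (inv_connection \<Gamma> (\<lambda>_. v) (\<lambda>_. w))" for v w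
    by (rule smooth_fun_cong[OF _ smooth_fun_const]) (simp add: const)
  \<comment> \<open>The differentiated field is constant on the group only, hence the detour through
    \<open>vdiff_cong\<close>.\<close>
  have "vdiff u (inv_connection \<Gamma> (\<lambda>_. v) (\<lambda>_. w)) p = 0" for u v w
    using vdiff_cong[OF const smooth p] vdiff_const[OF p] by simp
  then have "inv_connection \<Gamma> (\<lambda>_. u) (inv_connection \<Gamma> (\<lambda>_. v) (\<lambda>_. w)) p = \<Gamma> u (\<Gamma> v w)" for u v w
    using const[OF p] by (simp add: inv_connection_def[of _ _ "inv_connection \<Gamma> (\<lambda>_. v) (\<lambda>_. w)"])
  then show ?thesis
    by (simp add: curvature_def const[OF p])
qed

section \<open>Covariant differentiation along one-parameter subgroups\<close>

lemma exp_curve_mem: "exp_curve G T \<A> X u \<gamma> \<Longrightarrow> \<gamma> t \<in> carrier G"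
  using topspace_eq unfolding exp_curve_def smooth_curve_def continuous_map_def by fastforce

text \<open>The homomorphism law moves the derivative at t to the derivative at 0 of f translated by
  \<gamma>(t), and left invariance of \<open>X u\<close> evaluates it at \<gamma>(t).\<close>

lemma exp_curve_has_velocity:
  assumes \<gamma>: "exp_curve G T \<A> X u \<gamma>"
  shows "has_velocity \<A> X \<gamma> (\<lambda>t. u)"
  unfolding has_velocity_def
proof (intro allI impI)
  fix t and f :: "'g \<Rightarrow> real" assume f: "smooth_fun \<A> f"
  note mem = exp_curve_mem[OF \<gamma>]
  have "((\<lambda>s. f (\<gamma> t \<otimes> \<gamma> s)) has_real_derivative X u (\<lambda>q. f (\<gamma> t \<otimes> q)) \<one>) (at 0)"
    using \<gamma> smooth_fun_left_translate[OF f mem] by (auto simp: exp_curve_def)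
  moreover have "X u (\<lambda>q. f (\<gamma> t \<otimes> q)) \<one> = X u f (\<gamma> t)"
    using X_left_invariant[of u] f mem[of t] by (simp add: left_invariant_derivation_def)
  moreover have "\<gamma> t \<otimes> \<gamma> s = \<gamma> (s + t)" for s
    using \<gamma> unfolding exp_curve_def by (metis add.commute)
  ultimately show "((\<lambda>s. f (\<gamma> s)) has_real_derivative X u f (\<gamma> t)) (at t)"
    using DERIV_shift[of "\<lambda>s. f (\<gamma> s)" "X u f (\<gamma> t)" 0 t] by simp
qed

definition curve_derivative :: "('a \<Rightarrow> 'a \<Rightarrow> 'a) \<Rightarrow> 'a \<Rightarrow> (real \<Rightarrow> 'a) \<Rightarrow> real \<Rightarrow> 'a" where
  "curve_derivative \<Gamma> u y t = frechet_derivative y (at t) 1 + \<Gamma> u (y t)"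

lemma curve_derivative_eq:
  assumes "(y has_vector_derivative y') (at t)"
  shows "curve_derivative \<Gamma> u y t = y' + \<Gamma> u (y t)"
  using frechet_derivative_at[OF assms[unfolded has_vector_derivative_def], symmetric]
  by (simp add: curve_derivative_def)

lemma smooth_on_has_vector_derivative:
  fixes y :: "real \<Rightarrow> 'c::real_normed_vector"
  assumes "smooth_on UNIV y"
  shows "(y has_vector_derivative frechet_derivative y (at t) 1) (at t)"
proof -
  have d: "(y has_derivative frechet_derivative y (at t)) (at t)"
    using assms Ck_on_Suc_has_derivative unfolding smooth_on_def by blast
  have "frechet_derivative y (at t) s = s *\<^sub>R frechet_derivative y (at t) 1" for s
    using linear_scale[OF has_derivative_linear[OF d], of s 1] by simp
  with d show ?thesis
    unfolding has_vector_derivative_def by (blast intro: has_derivative_eq_rhs ext)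
qed

lemma covariant_derivative_along_exp_curve:
  assumes vel: "has_velocity \<A> X \<gamma> (\<lambda>t. u)" and \<Gamma>: "bilinear \<Gamma>"
  shows "covariant_derivative_along \<A> (inv_connection \<Gamma>) \<gamma> (\<lambda>t. u) (curve_derivative \<Gamma> u)"
  unfolding covariant_derivative_along_def
proof (intro conjI allI impI)
  have lin: "linear (\<Gamma> u)" using \<Gamma> by (simp add: bilinear_def)
  fix y :: "real \<Rightarrow> 'a" assume y: "smooth_on UNIV y"
  have "smooth_on UNIV (\<lambda>t. frechet_derivative y (at t) 1)"
    using y unfolding smooth_on_def by (metis Ck_on.simps(2))
  then show "smooth_on UNIV (curve_derivative \<Gamma> u y)"
    unfolding curve_derivative_def using lin y
    by (intro smooth_on_add smooth_on_linear[of "\<Gamma> u"]) (auto simp: linear_conv_bounded_linear)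
  note dy = smooth_on_has_vector_derivative[OF y]
  {
    fix z :: "real \<Rightarrow> 'a" and t assume "smooth_on UNIV z"
    then have "((\<lambda>s. y s + z s) has_vector_derivative
        frechet_derivative y (at t) 1 + frechet_derivative z (at t) 1) (at t)"
      by (intro has_vector_derivative_add dy smooth_on_has_vector_derivative)
    from curve_derivative_eq[OF this]
    show "curve_derivative \<Gamma> u (\<lambda>s. y s + z s) t = curve_derivative \<Gamma> u y t + curve_derivative \<Gamma> u z t"
      by (simp add: curve_derivative_def linear_add[OF lin])
  }
  fix h :: "real \<Rightarrow> real" and t assume h: "smooth_on UNIV h"
  have "(h has_real_derivative deriv h t) (at t)"
    using smooth_on_has_vector_derivative[OF h]
    by (metis DERIV_imp_deriv has_real_derivative_iff_has_vector_derivative)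
  from curve_derivative_eq[OF has_vector_derivative_scaleR[OF this dy]]
  show "curve_derivative \<Gamma> u (\<lambda>s. h s *\<^sub>R y s) t = h t *\<^sub>R curve_derivative \<Gamma> u y t + deriv h t *\<^sub>R y t"
    by (simp add: curve_derivative_def linear_scale[OF lin] scaleR_add_right)
next
  fix V W :: "'g \<Rightarrow> 'a" and t assume W: "smooth_fun \<A> W" and "V (\<gamma> t) = u"
  \<comment> \<open>For a field restricted to the curve, the velocity condition is applied to each
    coordinate, so the ordinary derivative is \<open>vdiff u W\<close>.\<close>
  have "((\<lambda>s. inner (W (\<gamma> s)) b) has_real_derivative X u (\<lambda>q. inner (W q) b) (\<gamma> t)) (at t)" for b
    using vel smooth_fun_inner_left[OF W] by (auto simp: has_velocity_def)
  then have "((\<lambda>s. W (\<gamma> s)) has_vector_derivative vdiff u W (\<gamma> t)) (at t)"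
    unfolding has_vector_derivative_def
    by (subst has_derivative_componentwise_within)
      (auto simp: has_field_derivative_def mult_commute_abs inner_vdiff)
  with \<open>V (\<gamma> t) = u\<close> show "curve_derivative \<Gamma> u (\<lambda>s. W (\<gamma> s)) t = inv_connection \<Gamma> V W (\<gamma> t)"
    by (simp add: curve_derivative_eq inv_connection_def)
qed

end

section \<open>Jacobi fields along a steady one-parameter subgroup\<close>

locale steady_lie_group =
  lie_group_with_algebra G T \<A> X br + steady_element br \<Lambda> u
  for G (structure) and T :: "'g topology" and \<A> :: "('g, 'a::euclidean_space) chart set"
    and X br \<Lambda> u
begin

abbreviation F where "F v \<equiv> \<Lambda>i (br (\<Lambda> u) v - br u (\<Lambda> v))"

lemma levi_civita_lc_coeff:
  "levi_civita \<A> X (left_invariant_metric br \<Lambda>) (inv_connection lc_coeff)"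
  unfolding left_invariant_metric_def
proof (rule levi_civita_inv_connection[OF bilinear_lc_coeff lc_coeff_torsion])
  show "bilinear (\<lambda>u v. killing br u (\<Lambda> v))"
    by (simp add: bilinear_def linear_iff killing_simps \<Lambda>_simps)
qed (rule lc_coeff_metric)

lemma linear_F: "linear F"
  by (auto simp: linear_iff br_simps \<Lambda>_simps algebra_simps)

lemma lc_coeff_self: "lc_coeff u u = 0"
  using br_\<Lambda>_eq_0 br_swap[of "\<Lambda> u" u] by (simp add: lc_coeff_def \<Lambda>_simps)

text \<open>Twice the connection coefficient is A - F. It enters the Jacobi equation doubled, which
  is how A and F appear there.\<close>

lemma lc_coeff_double: "lc_coeff u v + lc_coeff u v = br u v - F v"
  by (simp add: lc_coeff_def \<Lambda>_simps flip: scaleR_2)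

lemma exp_curve_geodesic:
  assumes \<gamma>: "exp_curve G T \<A> X u \<gamma>"
  shows "geodesic T \<A> X (left_invariant_metric br \<Lambda>) \<gamma>"
  unfolding geodesic_def
proof (intro conjI exI allI)
  show "smooth_curve T \<A> \<gamma>"
    using \<gamma> by (simp add: exp_curve_def)
  show vel: "has_velocity \<A> X \<gamma> (\<lambda>t. u)"
    by (rule exp_curve_has_velocity[OF \<gamma>])
  show "covariant_derivative_along \<A> (inv_connection lc_coeff) \<gamma> (\<lambda>t. u) (curve_derivative lc_coeff u)"
    by (rule covariant_derivative_along_exp_curve[OF vel bilinear_lc_coeff])
  show "curve_derivative lc_coeff u (\<lambda>t. u) t = 0" for t
    using curve_derivative_eq[OF has_vector_derivative_const] lc_coeff_self by simp
qed (rule levi_civita_lc_coeff)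

text \<open>The terms quadratic in \<open>lc_coeff u\<close> cancel between the second covariant
  derivative and the curvature. Only doubled coefficients and -A(Ay) remain, and these combine to
  the expanded form of (d/dt - F)(d/dt + A)y.\<close>

lemma jacobi_fieldI:
  assumes \<gamma>: "exp_curve G T \<A> X u \<gamma>" and y: "smooth_on UNIV y"
    and y': "\<And>t. (y has_vector_derivative y' t) (at t)"
    and y'': "\<And>t. (y' has_vector_derivative y'' t) (at t)"
    and eq: "\<And>t. y'' t + br u (y' t) = F (y' t + br u (y t))"
  shows "jacobi_field \<A> X br (left_invariant_metric br \<Lambda>) \<gamma> y"
  unfolding jacobi_field_def
proof (intro conjI exI allI)
  show vel: "has_velocity \<A> X \<gamma> (\<lambda>t. u)"
    by (rule exp_curve_has_velocity[OF \<gamma>])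
  let ?D = "curve_derivative lc_coeff u"
  show "covariant_derivative_along \<A> (inv_connection lc_coeff) \<gamma> (\<lambda>t. u) ?D"
    by (rule covariant_derivative_along_exp_curve[OF vel bilinear_lc_coeff])
  fix t
  note lc_simps = bilinear_radd[OF bilinear_lc_coeff] bilinear_rsub[OF bilinear_lc_coeff]
    bilinear_rzero[OF bilinear_lc_coeff] bilinear_lneg[OF bilinear_lc_coeff]
  have "linear (lc_coeff u)"
    using bilinear_lc_coeff by (simp add: bilinear_def)
  then have lc': "((\<lambda>t. lc_coeff u (y t)) has_vector_derivative lc_coeff u (y' t)) (at t)" for t
    by (intro bounded_linear.has_vector_derivative[OF _ y']) (simp add: linear_conv_bounded_linear)
  have "?D y = (\<lambda>t. y' t + lc_coeff u (y t))"
    using curve_derivative_eq[OF y'] by auto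
  then have DD: "?D (?D y) t = y'' t + lc_coeff u (y' t) + lc_coeff u (y' t + lc_coeff u (y t))"
    using curve_derivative_eq[OF has_vector_derivative_add[OF y'' lc']] by simp
  \<comment> \<open>Zero torsion moves u into the first slot of every coefficient; the remaining
    one, \<open>lc_coeff u u\<close>, vanishes since u is steady.\<close>
  define a where "a = br u (y t)"
  have 1: "lc_coeff (y t) u = lc_coeff u (y t) - a"
    using lc_coeff_torsion[of u "y t"] by (simp add: a_def algebra_simps)
  have 2: "lc_coeff a u = lc_coeff u a - br u a"
    using lc_coeff_torsion[of u a] by (simp add: algebra_simps)
  have 3: "br (y t) u = - a"
    unfolding a_def by (rule br_swap)
  have "curvature br (inv_connection lc_coeff) (\<gamma> t) (y t) u u =
      lc_coeff u a - lc_coeff u (lc_coeff u (y t)) + lc_coeff u a - br u a"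
    unfolding curvature_inv_connection[OF exp_curve_mem[OF \<gamma>] bilinear_lc_coeff] lc_coeff_self 1 3
    by (simp add: lc_simps 2)
  then have "?D (?D y) t + curvature br (inv_connection lc_coeff) (\<gamma> t) (y t) u u =
      y'' t + (lc_coeff u (y' t) + lc_coeff u (y' t)) + (lc_coeff u a + lc_coeff u a) - br u a"
    unfolding DD by (simp add: lc_simps)
  also have "\<dots> = y'' t + br u (y' t) - F (y' t + a)"
    unfolding lc_coeff_double linear_add[OF linear_F] by simp
  finally show "?D (?D y) t + curvature br (inv_connection lc_coeff) (\<gamma> t) (y t) u u = 0"
    using eq[of t] by (simp add: a_def)
qed (use y levi_civita_lc_coeff in auto)

text \<open>As \<open>A\<close> and \<open>B\<close> commute, \<open>y(t) = B\<^sup>-\<^sup>1 (e\<^sup>t\<^sup>G - e\<^sup>-\<^sup>t\<^sup>A) z\<close> satisfies \<open>y' + Ay = \<Lambda>\<^sup>-\<^sup>1 e\<^sup>t\<^sup>G z\<close>.\<close>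

lemma has_conjugate_pointI:
  assumes \<gamma>: "exp_curve G T \<A> X u \<gamma>"
    and B: "bij_betw (br (\<Lambda> u)) \<Omega> \<Omega>"
    and z: "z \<in> \<Omega>" "z \<noteq> 0" and \<tau>: "\<tau> > 0"
    and z_eq: "op_exp (\<lambda>w. \<tau> *\<^sub>R \<Lambda> (F (\<Lambda>i w))) z = op_exp (\<lambda>w. \<tau> *\<^sub>R - br u w) z"
  shows "has_conjugate_point \<A> X br (left_invariant_metric br \<Lambda>) \<gamma>"
proof -
  note lin_A = linear_br[of u]
  \<comment> \<open>B is invertible on \<Omega> only. A left inverse that is linear on the whole
    space keeps the differentiation lemmas for linear maps applicable.\<close>
  obtain Q where Q: "linear Q" "\<And>v. v \<in> \<Omega> \<Longrightarrow> Q (br (\<Lambda> u) v) = v"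
    using linear_exists_left_inverse_on[OF linear_br subspace_killing_perp] B
    unfolding bij_betw_def by metis
  have Q_comm: "Q (br u x) = br u (Q x)" if x: "x \<in> \<Omega>" for x
  proof -
    obtain w where w: "w \<in> \<Omega>" "x = br (\<Lambda> u) w"
      using B x unfolding bij_betw_def by blast
    show ?thesis
      unfolding w(2) br_br_\<Lambda>_commute using Q(2) w(1) range_br_subset_killing_perp by simp
  qed
  define H where "H w = \<Lambda> (F (\<Lambda>i w))" for w
  \<comment> \<open>In this form Q H equals \<open>\<Lambda>i\<close> - A Q on \<Omega>, from which
    the first-order equation for \<open>y\<close> follows.\<close>
  have H: "H w = br (\<Lambda> u) (\<Lambda>i w) - br u w" for w
    by (simp add: H_def)
  have lin_H: "linear H"
    by (auto simp: linear_iff H br_simps \<Lambda>_simps algebra_simps)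
  have H_perp: "H ` \<Omega> \<subseteq> \<Omega>"
  proof
    fix x assume "x \<in> H ` \<Omega>"
    then obtain w where w: "w \<in> \<Omega>" "x = H w" by blast
    then show "x \<in> \<Omega>"
      unfolding w(2) H using subspace_killing_perp B \<Lambda>i_perp range_br_subset_killing_perp
      by (intro subspace_diff) (auto simp: bij_betw_def)
  qed
  define E1 where "E1 t = op_exp (\<lambda>w. t *\<^sub>R H w) z" for t
  define E2 where "E2 t = op_exp (\<lambda>w. t *\<^sub>R - br u w) z" for t
  have lin_mA: "linear (\<lambda>w. - br u w)"
    using lin_A by (simp add: linear_compose_neg)
  have E1': "(E1 has_vector_derivative H (E1 t)) (at t)" for t
    unfolding E1_def[abs_def] by (rule op_exp_has_vector_derivative[OF lin_H])
  have E2': "(E2 has_vector_derivative - br u (E2 t)) (at t)" for t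
    unfolding E2_def[abs_def] by (rule op_exp_has_vector_derivative[OF lin_mA])
  have E1_perp: "E1 t \<in> \<Omega>" for t
    unfolding E1_def using H_perp subspace_killing_perp
    by (intro op_exp_mem_subspace z linear_compose_scale_right lin_H) (auto intro: subspace_scale)
  have E2_perp: "E2 t \<in> \<Omega>" for t
    unfolding E2_def using range_br_subset_killing_perp subspace_killing_perp
    by (intro op_exp_mem_subspace z linear_compose_scale_right lin_mA)
      (auto intro!: subspace_scale subspace_neg simp del: scaleR_minus_right)
  define y where "y t = Q (E1 t) - Q (E2 t)" for t
  have y': "(y has_vector_derivative \<Lambda>i (E1 t) - br u (y t)) (at t)" for t
  proof -
    have "(y has_vector_derivative Q (H (E1 t)) - Q (- br u (E2 t))) (at t)"
      unfolding y_def[abs_def] using Q(1)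
      by (intro has_vector_derivative_diff bounded_linear.has_vector_derivative[OF _ E1']
          bounded_linear.has_vector_derivative[OF _ E2']) (auto simp: linear_conv_bounded_linear)
    moreover have "Q (H (E1 t)) - Q (- br u (E2 t)) = \<Lambda>i (E1 t) - br u (y t)"
      using E1_perp E2_perp \<Lambda>i_perp
      by (simp add: H y_def linear_diff[OF Q(1)] linear_neg[OF Q(1)] Q(2) Q_comm br_simps)
    ultimately show ?thesis by simp
  qed
  have "jacobi_field \<A> X br (left_invariant_metric br \<Lambda>) \<gamma> y"
  proof (rule jacobi_fieldI[OF \<gamma> _ y'])
    have "smooth_on UNIV (\<lambda>t. Q (E1 t))" "smooth_on UNIV (\<lambda>t. - Q (E2 t))"
      using smooth_on_linear_ode[OF E1' lin_H Q(1)]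
        smooth_on_linear_ode[OF E2' lin_mA linear_compose_neg[OF Q(1)]] by auto
    from smooth_on_add[OF open_UNIV this] show "smooth_on UNIV y"
      by (simp add: y_def[abs_def])
    fix t
    show "((\<lambda>t. \<Lambda>i (E1 t) - br u (y t)) has_vector_derivative
        \<Lambda>i (H (E1 t)) - br u (\<Lambda>i (E1 t) - br u (y t))) (at t)"
      using linear_\<Lambda>i lin_A
      by (intro has_vector_derivative_diff bounded_linear.has_vector_derivative[OF _ E1']
          bounded_linear.has_vector_derivative[OF _ y']) (auto simp: linear_conv_bounded_linear)
    \<comment> \<open>Here y' + Ay is \<open>\<Lambda>i (E1 t)\<close>, and differentiating it
      applies F because \<open>\<Lambda>i\<close> H = F \<open>\<Lambda>i\<close>.\<close>
    show "\<Lambda>i (H (E1 t)) - br u (\<Lambda>i (E1 t) - br u (y t)) + br u (\<Lambda>i (E1 t) - br u (y t)) =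
        F (\<Lambda>i (E1 t) - br u (y t) + br u (y t))"
      by (simp add: H_def)
  qed
  moreover have "y 0 = 0"
    unfolding y_def E1_def E2_def op_exp_0_scaleR[OF lin_H] op_exp_0_scaleR[OF lin_mA] by simp
  moreover have "y \<tau> = 0"
    using z_eq by (simp add: y_def E1_def E2_def H_def)
  moreover have "\<exists>t. y t \<noteq> 0"
  \<comment> \<open>The first-order equation gives y'(0) = \<open>\<Lambda>i z\<close>, which is
    nonzero, so y cannot vanish identically.\<close>
  proof (rule ccontr)
    assume "\<not> (\<exists>t. y t \<noteq> 0)"
    then have "y = (\<lambda>t. 0)" by auto
    then have "((\<lambda>t. 0) has_vector_derivative \<Lambda>i z) (at 0)"
      using y'[of 0] by (simp add: E1_def op_exp_0_scaleR[OF lin_H, simplified] br_simps)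
    then have "\<Lambda>i z = 0"
      using vector_derivative_unique_at has_vector_derivative_const by blast
    then show False
      using z(2) \<Lambda>_inverse(1)[of z] linear_0[OF linear_\<Lambda>] by simp
  qed
  ultimately show ?thesis
    using \<tau> unfolding has_conjugate_point_def by blast
qed

text \<open>Both exponents preserve \<Omega>, hence so does the difference of exponentials; its zero
  determinant supplies the null vector z from which the Jacobi field is built.\<close>

lemma conjugate_point_if_det_eq_0:
  assumes \<gamma>: "exp_curve G T \<A> X u \<gamma>"
    and B: "bij_betw (br (\<Lambda> u)) \<Omega> \<Omega>" and \<tau>: "\<tau> > 0"
    and det: "det_on \<Omega> (\<lambda>v. op_exp (\<lambda>w. \<tau> *\<^sub>R \<Lambda> (F (\<Lambda>i w))) v - op_exp (\<lambda>w. - (\<tau> *\<^sub>R br u w)) v) = 0"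
  shows "has_conjugate_point \<A> X br (left_invariant_metric br \<Lambda>) \<gamma>"
proof -
  let ?S = "\<lambda>w. \<tau> *\<^sub>R \<Lambda> (F (\<Lambda>i w))" and ?R = "\<lambda>w. - (\<tau> *\<^sub>R br u w)"
  have lin: "linear ?S" "linear ?R"
    by (auto simp: linear_iff br_simps \<Lambda>_simps algebra_simps)
  have "br (\<Lambda> u) (\<Lambda>i w) \<in> \<Omega>" if "w \<in> \<Omega>" for w
    using B \<Lambda>i_perp[OF that] by (auto simp: bij_betw_def)
  then have S: "?S ` \<Omega> \<subseteq> \<Omega>"
    using subspace_killing_perp range_br_subset_killing_perp
    by (auto intro!: subspace_scale subspace_diff)
  have R: "?R ` \<Omega> \<subseteq> \<Omega>"
    using subspace_killing_perp range_br_subset_killing_perp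
    by (auto intro!: subspace_scale subspace_neg)
  have "\<exists>z\<in>\<Omega>. z \<noteq> 0 \<and> op_exp ?S z - op_exp ?R z = 0"
    by (rule det_on_eq_0_imp_kernel[OF subspace_killing_perp _ _ det])
      (use lin S R in \<open>auto intro!: linear_compose_sub linear_op_exp subspace_diff
        subspace_killing_perp op_exp_mem_subspace\<close>)
  then show ?thesis
    using has_conjugate_pointI[OF \<gamma> B _ _ \<tau>] by auto
qed

end

theorem lemma4p11:
  fixes G :: "('g, 'b) monoid_scheme"
    and T :: "'g topology"
    and \<A> :: "('g, 'a::euclidean_space) chart set"
    and X :: "'a \<Rightarrow> ('g \<Rightarrow> real) \<Rightarrow> 'g \<Rightarrow> real"
    and br :: "'a \<Rightarrow> 'a \<Rightarrow> 'a"
    and \<Lambda> :: "'a \<Rightarrow> 'a"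
    and u0 :: 'a
  assumes "lie_group_with_algebra G T \<A> X br"
    and "semisimple_lie_algebra br"
    and "linear \<Lambda>" and "bij \<Lambda>"
    and "\<forall>u v. killing br u (\<Lambda> v) = killing br (\<Lambda> u) v"
    and "riemannian_metric \<A> (left_invariant_metric br \<Lambda>)"
    and "semisimple_element br u0" and "regular_element br u0"
    and "\<Lambda> ` centralizer br u0 \<subseteq> centralizer br u0"
  shows "euler_arnold br \<Lambda> (\<lambda>t. u0) \<and> br u0 (\<Lambda> u0) = 0 \<and>
    (semisimple_element br (\<Lambda> u0) \<and> regular_element br (\<Lambda> u0) \<longrightarrow>
      (let \<Omega> = killing_perp br (centralizer br u0);
           \<Lambda>' = inv_into UNIV \<Lambda>;
           A = br u0;
           F = (\<lambda>v. \<Lambda>' (br (\<Lambda> u0) v - br u0 (\<Lambda> v)));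
           S = (\<lambda>v. inv_into \<Omega> (br (\<Lambda> u0)) (\<Lambda> v))
       in A ` \<Omega> \<subseteq> \<Omega> \<and> F ` \<Omega> \<subseteq> \<Omega> \<and>
          bij_betw (br (\<Lambda> u0)) \<Omega> \<Omega> \<and>
          \<Lambda> ` \<Omega> \<subseteq> \<Omega> \<and> S ` \<Omega> \<subseteq> \<Omega> \<and>
          (\<forall>v\<in>\<Omega>. S (F v) + A (S v) = v) \<and>
          (\<forall>\<gamma>. exp_curve G T \<A> X u0 \<gamma> \<longrightarrow>
             geodesic T \<A> X (left_invariant_metric br \<Lambda>) \<gamma> \<and>
             ((\<exists>\<tau>>0. det_on \<Omega> (\<lambda>v. op_exp (\<lambda>w. \<tau> *\<^sub>R \<Lambda> (F (\<Lambda>' w))) v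
                                  - op_exp (\<lambda>w. - (\<tau> *\<^sub>R A w)) v) = 0) \<longrightarrow>
               has_conjugate_point \<A> X br (left_invariant_metric br \<Lambda>) \<gamma>))))"
proof -
  interpret lie_group_with_algebra G T \<A> X br by fact
  interpret real_lie_algebra br by (rule real_lie_algebra)
  have pos: "killing br u (\<Lambda> u) > 0" if "u \<noteq> 0" for u
  proof -
    \<comment> \<open>The metric is the same form at every point, so positivity is read off at the
      identity.\<close>
    have "\<one>\<^bsub>G\<^esub> \<in> atlas_space \<A>" by (simp add: atlas_space_eq)
    then show ?thesis
      using assms(6) that by (auto simp: riemannian_metric_def left_invariant_metric_def)
  qed
  interpret steady_lie_group G T \<A> X br \<Lambda> u0
    by unfold_locales (fact linear_add[OF assms(3)] linear_scale[OF assms(3)] assms(4) assms(5)[rule_format]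
        pos assms(9))+
  show ?thesis
  proof (intro conjI impI)
    assume "semisimple_element br (\<Lambda> u0) \<and> regular_element br (\<Lambda> u0)"
    then have B: "bij_betw (br (\<Lambda> u0)) \<Omega> \<Omega>"
      using bij_br_\<Lambda>_perp assms(8) by blast
    let ?S = "\<lambda>v. inv_into \<Omega> (br (\<Lambda> u0)) (\<Lambda> v)"
    have B_mem: "br (\<Lambda> u0) v \<in> \<Omega>" if "v \<in> \<Omega>" for v
      using B that by (auto simp: bij_betw_def)
    have S_mem: "?S v \<in> \<Omega>" and B_S: "br (\<Lambda> u0) (?S v) = \<Lambda> v" if "v \<in> \<Omega>" for v
      using B \<Lambda>_perp[OF that] by (auto simp: bij_betw_def inv_into_into f_inv_into_f)
    have S_eq: "?S (F v) + br u0 (?S v) = v" if v: "v \<in> \<Omega>" for v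
    proof -
      have w: "v - br u0 (?S v) \<in> \<Omega>"
        by (intro subspace_diff subspace_killing_perp v range_br_subset_killing_perp)
      \<comment> \<open>With \<Lambda>v = B(Sv) and AB = BA, \<open>\<Lambda> (F v)\<close> becomes
        B(v - A(Sv)); injectivity of B on \<Omega> then gives S(Fv) = v - A(Sv).\<close>
      have "\<Lambda> (F v) = br (\<Lambda> u0) v - br u0 (br (\<Lambda> u0) (?S v))"
        by (simp add: B_S v)
      also have "\<dots> = br (\<Lambda> u0) (v - br u0 (?S v))"
        unfolding br_br_\<Lambda>_commute by (simp add: br_simps)
      finally have "?S (F v) = v - br u0 (?S v)"
        using B w by (simp add: bij_betw_def inv_into_f_f)
      then show ?thesis by simp
    qed
    have F_mem: "F v \<in> \<Omega>" if "v \<in> \<Omega>" for v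
      by (intro \<Lambda>i_perp subspace_diff subspace_killing_perp B_mem that range_br_subset_killing_perp)
    show "let \<Omega> = killing_perp br (centralizer br u0);
           \<Lambda>' = inv_into UNIV \<Lambda>;
           A = br u0;
           F = (\<lambda>v. \<Lambda>' (br (\<Lambda> u0) v - br u0 (\<Lambda> v)));
           S = (\<lambda>v. inv_into \<Omega> (br (\<Lambda> u0)) (\<Lambda> v))
       in A ` \<Omega> \<subseteq> \<Omega> \<and> F ` \<Omega> \<subseteq> \<Omega> \<and>
          bij_betw (br (\<Lambda> u0)) \<Omega> \<Omega> \<and>
          \<Lambda> ` \<Omega> \<subseteq> \<Omega> \<and> S ` \<Omega> \<subseteq> \<Omega> \<and>
          (\<forall>v\<in>\<Omega>. S (F v) + A (S v) = v) \<and>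
          (\<forall>\<gamma>. exp_curve G T \<A> X u0 \<gamma> \<longrightarrow>
             geodesic T \<A> X (left_invariant_metric br \<Lambda>) \<gamma> \<and>
             ((\<exists>\<tau>>0. det_on \<Omega> (\<lambda>v. op_exp (\<lambda>w. \<tau> *\<^sub>R \<Lambda> (F (\<Lambda>' w))) v
                                  - op_exp (\<lambda>w. - (\<tau> *\<^sub>R A w)) v) = 0) \<longrightarrow>
               has_conjugate_point \<A> X br (left_invariant_metric br \<Lambda>) \<gamma>))"
      unfolding Let_def
      using range_br_subset_killing_perp F_mem B \<Lambda>_perp S_mem S_eq exp_curve_geodesic
        conjugate_point_if_det_eq_0[OF _ B]
      by (intro conjI allI impI ballI image_subsetI) blast+
  qed (use steady br_\<Lambda>_eq_0 in auto)
qed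

end
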